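(* Consider the average-cost PHEV-charging dynamic program described in the context. Suppose that: (A) $0\le q(n)-q(n-1)\le q(n+1)-q(n)$ for all $n=1,2,\ldots$; (B1) under every $d\in\mathcal{D}$, there is positive probability that no vehicle arrives at the next stage; (B2) there exist a grid state $\bar s\in\mathcal{S}$ and a positive integer $m$ such that for every initial grid state $s_0\in\mathcal{S}$, under the sequence of zero aggregate charging decisions $A_0=A_1=\cdots=A_{m-1}=0$, the state $\bar s$ is visited with positive probability at least once within the first $m$ steps; (B3) the demand state $\{d_t\}$ evolves as an ergodic Markov chain. Then there exists an optimal stationary policy $\mu^*$ such that, at every system state $\mathbf{x}\in\mathcal{X}$, if the $i$th component of $\mu^*(\mathbf{x})$ is $1$ (vehicle $i$ is charged), then for every vehicle $j$ such that $i\preccurlyeq j$ at $\mathbf{x}$, the $j$th component of $\mu^*(\mathbf{x})$ is also $1$.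
   Context: **Model.** Time is discrete, $t=0,1,2,\ldots$. There are $N$ chargers; the vehicle connected to charger $i$ is called vehicle $i$. $\mathcal{I}_t\subseteq\{1,\ldots,N\}$ is the set of chargers connected to a vehicle at stage $t$. Vehicle $i$ has arrival time $\alpha_i$ and departure time (deadline) $\beta_i$ with $1\le\beta_i-\alpha_i\le B$; it can be charged at stages $\alpha_i,\ldots,\beta_i-1$, stays connected to its charger during these stages, and leaves at the beginning of stage $\beta_i$. For $i\in\mathcal{I}_t$ the state of vehicle $i$ is $x_{i,t}=(\lambda_{i,t},\gamma_{i,t})$, where $\lambda_{i,t}=\beta_i-t\ge 1$ is the number of remaining stages and $\gamma_{i,t}\in\{0,1,\ldots,E\}$ is the remaining processing time (number of units of charging still needed). For $i\notin\mathcal{I}_t$, $x_{i,t}=(0,0)$. An action is $\mathbf{a}_t=(a_{1,t},\ldots,a_{N,t})\in\{0,1\}^N$ ($a_{i,t}=1$ means vehicle $i$ is charged); it is feasible if $a_{i,t}\le\gamma_{i,t}$ for all $i$. Let $A_t=\sum_{i\in\mathcal{I}_t}a_{i,t}$. If vehicle $i$ remains connected at stage $t+1$, then $x_{i,t+1}=x_{i,t}-(1,a_{i,t})$. If a vehicle arrives at an empty charger $i$ at stage $t+1$, the state of charger $i$ becomes the initial state of this vehicle. The grid state $s_t$ lies in a finite set $\mathcal{S}$ and evolves randomly with a (time-homogeneous) law depending only on $s_t$ and the aggregate action $A_t$. The demand state $d_t$ lies in a finite set $\mathcal{D}$, evolves as a time-homogeneous Markov chain whose transitions are independent of $s_t$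 and $\mathbf{a}_t$, and determines the joint distribution of the numbers of future arriving vehicles and their initial states. Arrivals and their assignment to chargers are not affected by the charging actions. The system state $\mathbf{x}_t$ consists of $\{x_{i,t}\}_{i=1}^N$, $s_t$ and $d_t$; the set $\mathcal{X}$ of system states is finite, and the transition probabilities $p_{\mathbf{x},\mathbf{y}}(\mathbf{a})$ do not depend on the stage index. The stage cost is $$g(\mathbf{x}_t,\mathbf{a}_t)=C(A_t,s_t)+\sum_{j\in\mathcal{J}(\mathbf{x}_t)}q(\gamma_{j,t}-a_{j,t}),\qquad \mathcal{J}(\mathbf{x}_t)=\{j\in\mathcal{I}_t:\lambda_{j,t}=1\},$$ where $C$ is a real-valued charging cost function and $q:\mathbb{Z}_+\to[0,\infty)$ with $q(0)=0$ is the non-completion penalty. A feasible policy $\pi=\{\nu_0,\nu_1,\ldots\}$ is a sequence of decision rules such that $\nu_t(\mathbf{x}_t)$ is a feasible action for every $t$ and $\mathbf{x}_t$; it is stationary, denoted $\mu$, if $\nu_t=\mu$ for all $t$. The average cost of $\pi$ from initial state $\mathbf{x}_0$ is $$J_\pi(\mathbf{x}_0)=\limsup_{T\to\infty}\frac1T\,\mathbb{E}_\pi\Big\{\sum_{t=0}^{T-1}g(\mathbf{x}_t,\nu_t(\mathbf{x}_t))\Big\}.$$ A stationary policy is optimal if it attains the minimum of $J_\pi(\mathbf{x})$ over all feasible policies $\pi$, for every initial state $\mathbf{x}\in\mathcal{X}$. **Laxity and priority.** For $i\in\mathcal{I}_t$ the laxity is $\theta_{i,t}=\lambda_{i,t}-\gamma_{i,t}$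 if $\gamma_{i,t}>0$, and $\theta_{i,t}=B$ if $\gamma_{i,t}=0$. For connected vehicles $i,j\in\mathcal{I}_t$ in a given system state, $i\preccurlyeq j$ (vehicle $j$ has priority over $i$) means $\theta_{i,t}\ge\theta_{j,t}$ and $\gamma_{i,t}\le\gamma_{j,t}$, with at least one of the two inequalities strict. *)

theory Defs
  imports "HOL-Probability.Probability"
begin

section \<open>Finite Markov chains\<close>

text \<open>Law of the trajectory \<open>[x\<^sub>0, \<dots>, x\<^sub>n]\<close> of a (possibly time-inhomogeneous) chain, where \<open>K t x\<close>
  is the law of the state at time \<open>t + 1\<close> given state \<open>x\<close> at time \<open>t\<close>.\<close>

primrec traj :: "(nat \<Rightarrow> 'x \<Rightarrow> 'x pmf) \<Rightarrow> 'x \<Rightarrow> nat \<Rightarrow> 'x list pmf" where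
  "traj K x 0 = return_pmf [x]"
| "traj K x (Suc n) =
     bind_pmf (traj K x n) (\<lambda>xs. map_pmf (\<lambda>y. xs @ [y]) (K n (last xs)))"

definition nstep :: "('x \<Rightarrow> 'x pmf) \<Rightarrow> nat \<Rightarrow> 'x \<Rightarrow> 'x pmf" where
  "nstep P n x = map_pmf last (traj (\<lambda>_. P) x n)"

definition irreducible_chain :: "('x \<Rightarrow> 'x pmf) \<Rightarrow> bool" where
  "irreducible_chain P \<longleftrightarrow> (\<forall>x y. \<exists>n. pmf (nstep P n x) y > 0)"

definition aperiodic_chain :: "('x \<Rightarrow> 'x pmf) \<Rightarrow> bool" where
  "aperiodic_chain P \<longleftrightarrow> (\<forall>x. Gcd {n. n > 0 \<and> pmf (nstep P n x) x > 0} = 1)"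

text \<open>On a finite state space positive recurrence is implied by irreducibility.\<close>

definition ergodic_chain :: "('x::finite \<Rightarrow> 'x pmf) \<Rightarrow> bool" where
  "ergodic_chain P \<longleftrightarrow> irreducible_chain P \<and> aperiodic_chain P"


section \<open>The charging model\<close>

text \<open>
  Chargers, grid states and demand states are the elements of finite types \<open>'c\<close>, \<open>'s\<close>, \<open>'d\<close>.
  A vehicle state is a pair (remaining stages, remaining processing time); \<open>(0, 0)\<close> stands for an
  empty charger.

  \<^item> \<open>demand M d\<close> is the joint law, given the current demand state \<open>d\<close>, of the next demand state and
    of the list of initial states of the vehicles arriving at the next stage (its length is the
    number of arrivals). No conditional independence of the two is imposed.
  \<^item> \<open>assign M d l as\<close> is the law of the assignment of the arriving vehicles \<open>as\<close> to chargers, where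
    \<open>l i\<close> is the number of stages the vehicle already present at charger \<open>i\<close> still stays
    (\<open>0\<close> if \<open>i\<close> is empty at the arrival stage). In an outcome \<open>\<sigma>\<close>, \<open>\<sigma> i = Some k\<close> means that the
    vehicle \<open>as ! k\<close> is plugged into charger \<open>i\<close>. None of the arguments depends on the
    charging actions.
\<close>

type_synonym vehicle = "nat \<times> nat"
type_synonym ('c, 's, 'd) sys_state = "('c \<Rightarrow> vehicle) \<times> 's \<times> 'd"
type_synonym 'c action = "'c \<Rightarrow> nat"
type_synonym ('c, 's, 'd) decision_rule = "('c, 's, 'd) sys_state \<Rightarrow> 'c action"
type_synonym ('c, 's, 'd) policy = "nat \<Rightarrow> ('c, 's, 'd) decision_rule"

record ('c, 's, 'd) phev =
  max_stages :: nat
  max_work :: nat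
  grid :: "'s \<Rightarrow> nat \<Rightarrow> 's pmf"
  demand :: "'d \<Rightarrow> ('d \<times> vehicle list) pmf"
  assign :: "'d \<Rightarrow> ('c \<Rightarrow> nat) \<Rightarrow> vehicle list \<Rightarrow> ('c \<Rightarrow> nat option) pmf"
  charge_cost :: "nat \<Rightarrow> 's \<Rightarrow> real"
  penalty :: "nat \<Rightarrow> real"

definition vehicle_states :: "('c, 's, 'd) phev \<Rightarrow> vehicle set" where
  "vehicle_states M = {1..max_stages M} \<times> {0..max_work M}"

definition phev_model :: "('c::finite, 's::finite, 'd::finite) phev \<Rightarrow> bool" where
  "phev_model M \<longleftrightarrow>
     (\<forall>d. \<forall>(d', as) \<in> set_pmf (demand M d). set as \<subseteq> vehicle_states M) \<and>
     (\<forall>d l as. \<forall>\<sigma> \<in> set_pmf (assign M d l as).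
        dom \<sigma> \<subseteq> {i. l i = 0} \<and> ran \<sigma> \<subseteq> {..<length as} \<and> inj_on \<sigma> (dom \<sigma>)) \<and>
     (\<forall>n. penalty M n \<ge> 0) \<and> penalty M 0 = 0"

definition sys_states :: "('c::finite, 's::finite, 'd::finite) phev \<Rightarrow> ('c, 's, 'd) sys_state set" where
  "sys_states M = {(v, s, d). \<forall>i. v i = (0, 0) \<or> v i \<in> vehicle_states M}"

definition lam :: "('c, 's, 'd) sys_state \<Rightarrow> 'c \<Rightarrow> nat" where
  "lam x i = fst (fst x i)"

definition gam :: "('c, 's, 'd) sys_state \<Rightarrow> 'c \<Rightarrow> nat" where
  "gam x i = snd (fst x i)"

definition connected_chargers :: "('c, 's, 'd) sys_state \<Rightarrow> 'c set" where
  "connected_chargers x = {i. lam x i \<ge> 1}"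

definition feasible_action :: "('c, 's, 'd) sys_state \<Rightarrow> 'c action \<Rightarrow> bool" where
  "feasible_action x a \<longleftrightarrow> (\<forall>i. a i \<in> {0, 1} \<and> a i \<le> gam x i)"

definition aggregate :: "('c::finite, 's, 'd) sys_state \<Rightarrow> 'c action \<Rightarrow> nat" where
  "aggregate x a = (\<Sum>i\<in>connected_chargers x. a i)"

text \<open>A vehicle at charger \<open>i\<close> is still connected at the next stage iff \<open>lam x i \<ge> 2\<close>.\<close>

definition next_vehicles ::
    "('c, 's, 'd) sys_state \<Rightarrow> 'c action \<Rightarrow> vehicle list \<Rightarrow> ('c \<Rightarrow> nat option) \<Rightarrow> 'c \<Rightarrow> vehicle" where
  "next_vehicles x a as \<sigma> i =
     (if lam x i \<ge> 2 then (lam x i - 1, gam x i - a i)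
      else case \<sigma> i of Some k \<Rightarrow> as ! k | None \<Rightarrow> (0, 0))"

definition transition ::
    "('c::finite, 's::finite, 'd::finite) phev \<Rightarrow> ('c, 's, 'd) sys_state \<Rightarrow> 'c action
       \<Rightarrow> ('c, 's, 'd) sys_state pmf" where
  "transition M x a = (case x of (v, s, d) \<Rightarrow>
     bind_pmf (grid M s (aggregate x a)) (\<lambda>s'.
     bind_pmf (demand M d) (\<lambda>(d', as).
     bind_pmf (assign M d (\<lambda>i. lam x i - 1) as) (\<lambda>\<sigma>.
     return_pmf (next_vehicles x a as \<sigma>, s', d')))))"

definition departing :: "('c, 's, 'd) sys_state \<Rightarrow> 'c set" where
  "departing x = {j \<in> connected_chargers x. lam x j = 1}"

definition stage_cost ::
    "('c::finite, 's::finite, 'd::finite) phev \<Rightarrow> ('c, 's, 'd) sys_state \<Rightarrow> 'c action \<Rightarrow> real" where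
  "stage_cost M x a =
     charge_cost M (aggregate x a) (fst (snd x)) + (\<Sum>j\<in>departing x. penalty M (gam x j - a j))"


section \<open>Policies and average cost\<close>

definition feasible_policy ::
    "('c::finite, 's::finite, 'd::finite) phev \<Rightarrow> ('c, 's, 'd) policy \<Rightarrow> bool" where
  "feasible_policy M \<pi> \<longleftrightarrow> (\<forall>t. \<forall>x \<in> sys_states M. feasible_action x (\<pi> t x))"

definition stationary :: "('c, 's, 'd) decision_rule \<Rightarrow> ('c, 's, 'd) policy" where
  "stationary \<mu> = (\<lambda>t. \<mu>)"

definition expected_cost ::
    "('c::finite, 's::finite, 'd::finite) phev \<Rightarrow> ('c, 's, 'd) policy \<Rightarrow> ('c, 's, 'd) sys_state
       \<Rightarrow> nat \<Rightarrow> real" where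
  "expected_cost M \<pi> x\<^sub>0 T =
     measure_pmf.expectation (traj (\<lambda>t x. transition M x (\<pi> t x)) x\<^sub>0 T)
       (\<lambda>xs. \<Sum>t<T. stage_cost M (xs ! t) (\<pi> t (xs ! t)))"

definition average_cost ::
    "('c::finite, 's::finite, 'd::finite) phev \<Rightarrow> ('c, 's, 'd) policy \<Rightarrow> ('c, 's, 'd) sys_state
       \<Rightarrow> ereal" where
  "average_cost M \<pi> x\<^sub>0 = limsup (\<lambda>T. ereal (1 / real T * expected_cost M \<pi> x\<^sub>0 T))"

definition optimal_stationary ::
    "('c::finite, 's::finite, 'd::finite) phev \<Rightarrow> ('c, 's, 'd) decision_rule \<Rightarrow> bool" where
  "optimal_stationary M \<mu> \<longleftrightarrow>
     feasible_policy M (stationary \<mu>) \<and>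
     (\<forall>x \<in> sys_states M. \<forall>\<pi>. feasible_policy M \<pi> \<longrightarrow>
        average_cost M (stationary \<mu>) x \<le> average_cost M \<pi> x)"


section \<open>Laxity and priority\<close>

definition laxity :: "('c, 's, 'd) phev \<Rightarrow> ('c, 's, 'd) sys_state \<Rightarrow> 'c \<Rightarrow> int" where
  "laxity M x i = (if gam x i > 0 then int (lam x i) - int (gam x i) else int (max_stages M))"

text \<open>\<open>has_priority M x i j\<close> is \<open>i \<preceq> j\<close>: vehicle \<open>j\<close> has priority over vehicle \<open>i\<close>.\<close>

definition has_priority :: "('c, 's, 'd) phev \<Rightarrow> ('c, 's, 'd) sys_state \<Rightarrow> 'c \<Rightarrow> 'c \<Rightarrow> bool" where
  "has_priority M x i j \<longleftrightarrow>
     i \<in> connected_chargers x \<and> j \<in> connected_chargers x \<and>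
     laxity M x i \<ge> laxity M x j \<and> gam x i \<le> gam x j \<and>
     (laxity M x i > laxity M x j \<or> gam x i < gam x j)"

end

(*
The interchange argument needs a relative value function h of the undiscounted problem with three
properties: raising the remaining work of a vehicle by one unit costs at most the penalty increment
at the present work; for a vehicle that can no longer finish it costs at least the increment at the
work that is bound to remain; and it costs less to raise the vehicle of lower priority.  The Bellman
operator T preserves these properties but discounting does not, so h is not obtained from discounted
problems.  Instead, with V the penalties that are already unavoidable, (1 - t) T + t V is a
contraction that preserves the properties, and h is a limit of its normalised approximate fixed
points as t tends to 0.  Their spans are bounded uniformly in t: under zero charging the grid and
demand chains are independent and the demand chain is aperiodic, so each of certain "hub" states
(all chargers empty, grid state sbar) is reachable from everywhere, while under every policy some
hub is reachable from everywhere because arrivals may stop until all vehicles have left.  Among the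
minimising actions, one that maximises a weight strictly monotone in the priority order must respect
that order.
*)

theory Submission
  imports Defs
begin

section \<open>Optimality equation of a finite Markov decision process\<close>

text \<open>Bolzano-Weierstrass is applied to one point at a time; each new point thins the
  subsequence found so far, which preserves the earlier limits.\<close>

lemma finite_pointwise_subseq:
  fixes f :: "nat \<Rightarrow> 'x \<Rightarrow> real"
  assumes "finite S" "\<And>x. x \<in> S \<Longrightarrow> bounded (range (\<lambda>n. f n x))"
  shows "\<exists>g r. strict_mono (r :: nat \<Rightarrow> nat) \<and> (\<forall>x\<in>S. (\<lambda>n. f (r n) x) \<longlonglongrightarrow> g x)"
  using assms
proof (induction S rule: finite_induct)
  case empty
  show ?case by (rule exI, rule exI[of _ id]) (auto simp: strict_mono_def)
next
  case (insert z S)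
  then obtain g r where r: "strict_mono (r :: nat \<Rightarrow> nat)" "\<And>x. x \<in> S \<Longrightarrow> (\<lambda>n. f (r n) x) \<longlonglongrightarrow> g x"
    by auto
  have "bounded (range (\<lambda>n. f (r n) z))"
    by (rule bounded_subset[OF insert.prems[of z]]) auto
  then obtain l r' where r': "strict_mono (r' :: nat \<Rightarrow> nat)" "((\<lambda>n. f (r n) z) \<circ> r') \<longlonglongrightarrow> l"
    using bounded_imp_convergent_subsequence[of "\<lambda>n. f (r n) z"] by blast
  show ?case
  proof (intro exI conjI ballI)
    show "strict_mono (r \<circ> r')" using r r' by (simp add: strict_mono_o)
    fix x assume "x \<in> insert z S"
    show "(\<lambda>n. f ((r \<circ> r') n) x) \<longlonglongrightarrow> (g(z := l)) x"
    proof (cases "x = z")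
      case True
      then show ?thesis using r'(2) by (simp add: o_def)
    next
      case False
      then show ?thesis
        using LIMSEQ_subseq_LIMSEQ[OF r(2) r'(1)] \<open>x \<in> insert z S\<close> by (simp add: o_def)
    qed
  qed
qed

text \<open>Each edge adds \<open>C\<close> and multiplies the bound by 1/\<open>p\<close>; since
  \<open>p\<close> \<le> 1, every added constant is absorbed by the largest power of
  1/\<open>p\<close>.\<close>

lemma relpow_growth_bound:
  fixes f :: "'x \<Rightarrow> real"
  assumes step: "\<And>x y. (x, y) \<in> R \<Longrightarrow> p * f y \<le> f x + C"
    and p: "0 < p" "p \<le> 1" and C: "0 \<le> C"
    and "(x, y) \<in> R ^^ n" and x: "f x \<le> 0"
  shows "f y \<le> real n * C / p ^ n"
  using \<open>(x, y) \<in> R ^^ n\<close>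
proof (induction n arbitrary: y)
  case 0
  then show ?case using x by simp
next
  case (Suc n)
  then obtain u where u: "(x, u) \<in> R ^^ n" "(u, y) \<in> R" by auto
  have "p * f y \<le> real n * C / p ^ n + C" using step[OF u(2)] Suc.IH[OF u(1)] by linarith
  also have "\<dots> \<le> real n * C / p ^ n + C / p ^ n"
    using C p by (simp add: le_divide_eq mult_left_le power_le_one)
  also have "\<dots> = p * (real (Suc n) * C / p ^ Suc n)" using p by (simp add: field_simps)
  finally show ?case using p by (simp only: mult_le_cancel_left_pos)
qed

locale finite_mdp =
  fixes S :: "'x set" and Act :: "'x \<Rightarrow> 'a set" and c :: "'x \<Rightarrow> 'a \<Rightarrow> real"
    and P :: "'x \<Rightarrow> 'a \<Rightarrow> 'x pmf"
  assumes finite_S: "finite S" and S_ne: "S \<noteq> {}"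
    and finite_Act: "x \<in> S \<Longrightarrow> finite (Act x)" and Act_ne: "x \<in> S \<Longrightarrow> Act x \<noteq> {}"
    and P_closed: "x \<in> S \<Longrightarrow> a \<in> Act x \<Longrightarrow> set_pmf (P x a) \<subseteq> S"
begin

definition Q :: "('x \<Rightarrow> real) \<Rightarrow> 'x \<Rightarrow> 'a \<Rightarrow> real" where
  "Q W x a = c x a + measure_pmf.expectation (P x a) W"

definition bellman :: "('x \<Rightarrow> real) \<Rightarrow> 'x \<Rightarrow> real" where
  "bellman W x = Min (Q W x ` Act x)"

definition edges :: "('x \<Rightarrow> 'a) \<Rightarrow> ('x \<times> 'x) set" where
  "edges \<mu> = {(x, y). x \<in> S \<and> y \<in> set_pmf (P x (\<mu> x))}"

lemma bellman_le: "x \<in> S \<Longrightarrow> a \<in> Act x \<Longrightarrow> bellman W x \<le> Q W x a"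
  by (simp add: bellman_def finite_Act)

lemma bellman_attained: "x \<in> S \<Longrightarrow> \<exists>a\<in>Act x. bellman W x = Q W x a"
  using Min_in[of "Q W x ` Act x"] finite_Act[of x] Act_ne[of x] unfolding bellman_def by blast

lemma expectation_sum:
  fixes W :: "'x \<Rightarrow> real"
  assumes "x \<in> S" "a \<in> Act x"
  shows "measure_pmf.expectation (P x a) W = (\<Sum>y\<in>S. pmf (P x a) y * W y)"
  using integral_measure_pmf[OF finite_S, of "P x a" W] P_closed[OF assms] by auto

lemma sum_pmf: "x \<in> S \<Longrightarrow> a \<in> Act x \<Longrightarrow> (\<Sum>y\<in>S. pmf (P x a) y) = 1"
  using sum_pmf_eq_1[OF finite_S] P_closed by blast

lemma expectation_le_add:
  fixes W W' :: "'x \<Rightarrow> real"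
  assumes "x \<in> S" "a \<in> Act x" "\<And>y. y \<in> S \<Longrightarrow> W y \<le> W' y + e"
  shows "measure_pmf.expectation (P x a) W \<le> measure_pmf.expectation (P x a) W' + e"
proof -
  have "(\<Sum>y\<in>S. pmf (P x a) y * W y) \<le> (\<Sum>y\<in>S. pmf (P x a) y * (W' y + e))"
    by (intro sum_mono mult_left_mono assms(3)) auto
  also have "\<dots> = (\<Sum>y\<in>S. pmf (P x a) y * W' y) + e"
    using sum_pmf[OF assms(1,2)] by (simp add: distrib_left sum.distrib sum_distrib_right[symmetric])
  finally show ?thesis using assms by (simp add: expectation_sum)
qed

lemma bellman_le_add:
  assumes "x \<in> S" "\<And>y. y \<in> S \<Longrightarrow> W y \<le> W' y + e"
  shows "bellman W x \<le> bellman W' x + e"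
proof -
  obtain a where a: "a \<in> Act x" "bellman W' x = Q W' x a" using bellman_attained assms by blast
  then show ?thesis
    using bellman_le[OF assms(1) a(1), of W] expectation_le_add[OF assms(1) a(1), of W W' e] assms(2)
    by (simp add: Q_def)
qed

lemma bellman_nonexpansive:
  assumes "x \<in> S" "\<And>y. y \<in> S \<Longrightarrow> \<bar>W y - W' y\<bar> \<le> e"
  shows "\<bar>bellman W x - bellman W' x\<bar> \<le> e"
proof -
  have "W y \<le> W' y + e" "W' y \<le> W y + e" if "y \<in> S" for y using assms(2)[OF that] by auto
  then show ?thesis
    using bellman_le_add[OF assms(1), of W W' e] bellman_le_add[OF assms(1), of W' W e] by auto
qed

lemma bellman_add_const: "x \<in> S \<Longrightarrow> bellman (\<lambda>y. W y + b) x = bellman W x + b"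
  using bellman_le_add[of x "\<lambda>y. W y + b" W b] bellman_le_add[of x W "\<lambda>y. W y + b" "-b"] by force

section \<open>Uniform span bounds from reachability\<close>

lemma pmf_bounded_below:
  "\<exists>p>0. p \<le> 1 \<and> (\<forall>x\<in>S. \<forall>a\<in>Act x. \<forall>y\<in>set_pmf (P x a). p \<le> pmf (P x a) y)"
proof -
  \<comment> \<open>The extra 1 makes \<open>Min B\<close> at most 1, as
    \<open>relpow_growth_bound\<close> requires of \<open>p\<close>.\<close>
  define B where "B = insert 1 ((\<lambda>(x, a, y). pmf (P x a) y) ` (SIGMA x:S. SIGMA a:Act x. set_pmf (P x a)))"
  have fin: "finite B" unfolding B_def
    by (intro finite.insertI finite_imageI finite_SigmaI finite_S finite_Act)
       (auto intro: finite_subset[OF P_closed finite_S])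
  have pos: "\<And>b. b \<in> B \<Longrightarrow> 0 < b" by (auto simp: B_def pmf_positive)
  show ?thesis
  proof (intro exI[of _ "Min B"] conjI ballI)
    have "Min B \<in> B" using fin by (intro Min_in) (auto simp: B_def)
    then show "0 < Min B" by (rule pos)
    show "Min B \<le> 1" using fin by (intro Min_le) (auto simp: B_def)
    fix x a y assume "x \<in> S" "a \<in> Act x" "y \<in> set_pmf (P x a)"
    then show "Min B \<le> pmf (P x a) y" using fin by (intro Min_le) (auto simp: B_def image_iff)
  qed
qed

lemma expectation_ge_weighted:
  fixes f :: "'x \<Rightarrow> real"
  assumes "x \<in> S" "a \<in> Act x" "y \<in> set_pmf (P x a)" "p \<le> pmf (P x a) y"
    and "\<And>y. y \<in> S \<Longrightarrow> 0 \<le> f y"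
  shows "p * f y \<le> measure_pmf.expectation (P x a) f"
proof -
  have y: "y \<in> S" using assms P_closed by blast
  have "p * f y \<le> pmf (P x a) y * f y" using assms(4,5) y by (intro mult_right_mono) auto
  also have "\<dots> \<le> (\<Sum>y\<in>S. pmf (P x a) y * f y)"
    using y finite_S assms(5) by (intro member_le_sum) auto
  finally show ?thesis using assms by (simp add: expectation_sum)
qed

lemma expectation_affine:
  fixes W :: "'x \<Rightarrow> real"
  assumes "x \<in> S" "a \<in> Act x"
  shows "measure_pmf.expectation (P x a) (\<lambda>y. b - W y) = b - measure_pmf.expectation (P x a) W"
    and "measure_pmf.expectation (P x a) (\<lambda>y. W y - b) = measure_pmf.expectation (P x a) W - b"
  using sum_pmf[OF assms]
  by (simp_all add: expectation_sum[OF assms] right_diff_distrib sum_subtractf sum_distrib_right[symmetric])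

text \<open>A path can be shortened until it has no more steps than there are edges, so the bound
  depends neither on the path nor on \<open>\<mu>\<close>.\<close>

lemma edges_path_bounded:
  assumes "(x, y) \<in> (edges \<mu>)\<^sup>*" "\<And>x. x \<in> S \<Longrightarrow> \<mu> x \<in> Act x"
    and step: "\<And>x y. (x, y) \<in> edges \<mu> \<Longrightarrow> p * f y \<le> f x + C"
    and p: "0 < p" "p \<le> 1" and C: "0 \<le> C" and x: "f x \<le> 0"
  defines "N \<equiv> card (S \<times> S)"
  shows "f y \<le> real N * C / p ^ N"
proof -
  have sub: "edges \<mu> \<subseteq> S \<times> S" using assms(2) P_closed by (fastforce simp: edges_def)
  then have fin: "finite (edges \<mu>)" using finite_S finite_subset by blast
  obtain n where n: "n \<le> card (edges \<mu>)" "(x, y) \<in> edges \<mu> ^^ n"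
    using assms(1) rtrancl_finite_eq_relpow[OF fin] by auto
  have nN: "n \<le> N" using n(1) card_mono[OF _ sub] finite_S by (auto simp: N_def)
  have "f y \<le> real n * C / p ^ n" by (rule relpow_growth_bound[where R = "edges \<mu>" and f = f, OF step p C n(2) x])
  also have "\<dots> \<le> real N * C / p ^ N"
    using nN p C by (intro frac_le mult_right_mono mult_nonneg_nonneg power_decreasing) auto
  finally show ?thesis .
qed

text \<open>Along \<open>\<nu>\<close> from a maximiser of \<open>h\<close>,
  \<open>bellman h x \<le> Q h x (\<nu> x)\<close> limits the fall of \<open>h\<close>, so
  \<open>h\<close> is within a constant of its maximum on all of \<open>Z\<close>. Along a greedy
  rule from a minimiser, equality limits the rise, so \<open>h\<close> is within a constant of its
  minimum at some point of \<open>Z\<close>. The two estimates meet at that point.\<close>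

lemma span_bound:
  assumes Z: "\<And>x w. x \<in> S \<Longrightarrow> w \<in> Z \<Longrightarrow> (x, w) \<in> (edges \<nu>)\<^sup>*"
    and \<nu>: "\<And>x. x \<in> S \<Longrightarrow> \<nu> x \<in> Act x"
    and reach: "\<And>\<mu> x. (\<And>x. x \<in> S \<Longrightarrow> \<mu> x \<in> Act x) \<Longrightarrow> x \<in> S \<Longrightarrow> \<exists>w\<in>Z. (x, w) \<in> (edges \<mu>)\<^sup>*"
    and C: "\<And>x a. x \<in> S \<Longrightarrow> a \<in> Act x \<Longrightarrow> \<bar>c x a\<bar> \<le> C"
  shows "\<exists>K. \<forall>h. (\<forall>x\<in>S. \<bar>bellman h x - h x\<bar> \<le> b) \<longrightarrow> (\<forall>x\<in>S. \<forall>y\<in>S. \<bar>h x - h y\<bar> \<le> K)"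
proof -
  obtain p where p: "0 < p" "p \<le> 1"
    "\<And>x a y. x \<in> S \<Longrightarrow> a \<in> Act x \<Longrightarrow> y \<in> set_pmf (P x a) \<Longrightarrow> p \<le> pmf (P x a) y"
    using pmf_bounded_below by blast
  define K where "K = real (card (S \<times> S)) * (\<bar>C\<bar> + \<bar>b\<bar>) / p ^ card (S \<times> S)"
  show ?thesis
  proof (intro exI[of _ "2 * K"] allI impI ballI)
    fix h x1 x2 assume h: "\<forall>x\<in>S. \<bar>bellman h x - h x\<bar> \<le> b" and x12: "x1 \<in> S" "x2 \<in> S"
    define hi where "hi = Max (h ` S)"
    define lo where "lo = Min (h ` S)"
    have bnd: "lo \<le> h x" "h x \<le> hi" if "x \<in> S" for x
      using that finite_S by (auto simp: hi_def lo_def)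
    obtain xh where xh: "xh \<in> S" "h xh = hi"
    proof -
      have "hi \<in> h ` S" unfolding hi_def using finite_S S_ne by (intro Max_in) auto
      then show ?thesis using that by fastforce
    qed
    obtain xl where xl: "xl \<in> S" "h xl = lo"
    proof -
      have "lo \<in> h ` S" unfolding lo_def using finite_S S_ne by (intro Min_in) auto
      then show ?thesis using that by fastforce
    qed
    obtain \<mu> where \<mu>: "\<And>x. x \<in> S \<Longrightarrow> \<mu> x \<in> Act x \<and> bellman h x = Q h x (\<mu> x)"
      by (rule that[of "\<lambda>x. SOME a. a \<in> Act x \<and> bellman h x = Q h x a"])
        (rule someI_ex, use bellman_attained[of _ h] in blast)
    obtain w where w: "w \<in> Z" "(xl, w) \<in> (edges \<mu>)\<^sup>*" using reach[of \<mu> xl] \<mu> xl by blast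
    have "hi - h w \<le> K" unfolding K_def
    proof (rule edges_path_bounded[where f = "\<lambda>y. hi - h y", OF Z[OF xh(1) w(1)] \<nu> _ p(1,2)])
      fix x y assume "(x, y) \<in> edges \<nu>"
      then have xy: "x \<in> S" "y \<in> set_pmf (P x (\<nu> x))" by (auto simp: edges_def)
      have "p * (hi - h y) \<le> hi - measure_pmf.expectation (P x (\<nu> x)) h"
        using expectation_ge_weighted[OF xy(1) \<nu>[OF xy(1)] xy(2) p(3)[OF xy(1) \<nu>[OF xy(1)] xy(2)],
            of "\<lambda>y. hi - h y"] bnd
        by (simp add: expectation_affine[OF xy(1) \<nu>[OF xy(1)]])
      then show "p * (hi - h y) \<le> (hi - h x) + (\<bar>C\<bar> + \<bar>b\<bar>)"
        using bellman_le[OF xy(1) \<nu>[OF xy(1)], of h] h[rule_format, OF xy(1)] C[OF xy(1) \<nu>[OF xy(1)]]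
        by (auto simp: Q_def)
    qed (use xh in auto)
    moreover have "h w - lo \<le> K" unfolding K_def
    proof (rule edges_path_bounded[where f = "\<lambda>y. h y - lo", OF w(2) _ _ p(1,2)])
      fix x y assume "(x, y) \<in> edges \<mu>"
      then have xy: "x \<in> S" "y \<in> set_pmf (P x (\<mu> x))" by (auto simp: edges_def)
      have m: "\<mu> x \<in> Act x" using \<mu> xy by auto
      have "p * (h y - lo) \<le> measure_pmf.expectation (P x (\<mu> x)) h - lo"
        using expectation_ge_weighted[OF xy(1) m xy(2) p(3)[OF xy(1) m xy(2)], of "\<lambda>y. h y - lo"] bnd
        by (simp add: expectation_affine[OF xy(1) m])
      then show "p * (h y - lo) \<le> (h x - lo) + (\<bar>C\<bar> + \<bar>b\<bar>)"
        using \<mu>[OF xy(1)] h[rule_format, OF xy(1)] C[OF xy(1) m] by (auto simp: Q_def)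
    qed (use \<mu> xl in auto)
    ultimately show "\<bar>h x1 - h x2\<bar> \<le> 2 * K" using bnd[OF x12(1)] bnd[OF x12(2)] by auto
  qed
qed

text \<open>The closure conditions follow the construction: \<open>\<Phi>_bellman\<close> and
  \<open>\<Phi>_convex\<close> keep the iterates of the perturbed operator in the class,
  \<open>\<Phi>_const\<close> permits normalisation at one state, and \<open>\<Phi>_lim\<close>
  permits the limit of vanishing perturbation.\<close>

theorem acoe_solution_in_class:
  fixes \<Phi> :: "('x \<Rightarrow> real) \<Rightarrow> bool"
  assumes Z: "\<And>x w. x \<in> S \<Longrightarrow> w \<in> Z \<Longrightarrow> (x, w) \<in> (edges \<nu>)\<^sup>*"
    and \<nu>: "\<And>x. x \<in> S \<Longrightarrow> \<nu> x \<in> Act x"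
    and reach: "\<And>\<mu> x. (\<And>x. x \<in> S \<Longrightarrow> \<mu> x \<in> Act x) \<Longrightarrow> x \<in> S \<Longrightarrow> \<exists>w\<in>Z. (x, w) \<in> (edges \<mu>)\<^sup>*"
    and \<Phi>_V: "\<Phi> V"
    and \<Phi>_bellman: "\<And>W. \<Phi> W \<Longrightarrow> \<Phi> (bellman W)"
    and \<Phi>_convex: "\<And>W W' t. \<Phi> W \<Longrightarrow> \<Phi> W' \<Longrightarrow> 0 < t \<Longrightarrow> t < 1 \<Longrightarrow> \<Phi> (\<lambda>x. (1 - t) * W x + t * W' x)"
    and \<Phi>_const: "\<And>W b. \<Phi> W \<Longrightarrow> \<Phi> (\<lambda>x. W x + b)"
    and \<Phi>_lim: "\<And>w W. (\<And>n. \<Phi> (w n)) \<Longrightarrow> (\<And>x. x \<in> S \<Longrightarrow> (\<lambda>n. w n x) \<longlonglongrightarrow> W x) \<Longrightarrow> \<Phi> W"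
  shows "\<exists>\<rho> h. \<Phi> h \<and> (\<forall>x\<in>S. bellman h x = \<rho> + h x)"
proof -
  obtain z where z: "z \<in> S" using S_ne by blast
  \<comment> \<open>The inserted 1 lets \<open>C\<close> dominate iteration errors \<open>t\<close>
    below 1.\<close>
  define C where "C = Max (insert 1 ((\<lambda>x. \<bar>V x\<bar>) ` S \<union> (\<lambda>(x, a). \<bar>c x a\<bar>) ` (SIGMA x:S. Act x)))"
  have finC: "finite (insert 1 ((\<lambda>x. \<bar>V x\<bar>) ` S \<union> (\<lambda>(x, a). \<bar>c x a\<bar>) ` (SIGMA x:S. Act x)))"
    by (intro finite.insertI finite_UnI finite_imageI finite_SigmaI finite_S finite_Act)
  have C1: "1 \<le> C" unfolding C_def using finC by (intro Max_ge) auto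
  have CV: "\<bar>V x\<bar> \<le> C" if "x \<in> S" for x unfolding C_def using finC that by (intro Max_ge) auto
  have Cc: "\<bar>c x a\<bar> \<le> C" if "x \<in> S" "a \<in> Act x" for x a
    unfolding C_def using finC that by (intro Max_ge) auto
  \<comment> \<open>The residual bound is free of \<open>t\<close>: \<open>t * bellman h\<close>
    contributes 2 \<open>C\<close>, \<open>t * V\<close> contributes \<open>C\<close>, and so does
    the iteration error.\<close>
  obtain K where K: "\<And>h x y. (\<And>x. x \<in> S \<Longrightarrow> \<bar>bellman h x - h x\<bar> \<le> 4 * C) \<Longrightarrow>
      x \<in> S \<Longrightarrow> y \<in> S \<Longrightarrow> \<bar>h x - h y\<bar> \<le> K"
    using span_bound[OF Z \<nu> reach Cc, of "4 * C"] by blast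
  have bellman_bound: "\<bar>bellman W x\<bar> \<le> C + b" if x: "x \<in> S" and W: "\<And>y. y \<in> S \<Longrightarrow> \<bar>W y\<bar> \<le> b" for W x b
  proof -
    have "\<bar>bellman W x - bellman (\<lambda>_. 0) x\<bar> \<le> b" by (rule bellman_nonexpansive[OF x]) (use W in auto)
    moreover obtain a where "a \<in> Act x" "bellman (\<lambda>_. 0) x = Q (\<lambda>_. 0) x a"
      using bellman_attained[OF x] by blast
    ultimately show ?thesis using Cc[OF x, of a] by (auto simp: Q_def)
  qed
  have approx: "\<exists>w \<rho>. \<Phi> w \<and> \<bar>\<rho>\<bar> \<le> C \<and> (\<forall>x\<in>S. \<bar>w x\<bar> \<le> K) \<and>
      (\<forall>x\<in>S. \<bar>bellman w x - (\<rho> + w x)\<bar> \<le> t * (K + 5 * C + 1))" if t: "0 < t" "t < 1" for t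
  proof -
    \<comment> \<open>No exact fixed point of \<open>G\<close> is taken: a late iterate with error
      at most \<open>t\<close> suffices, and it lies in the class by induction.\<close>
    define G where "G W x = (1 - t) * bellman W x + t * V x" for W x
    define u where "u n = (G ^^ n) V" for n
    have u_Suc: "u (Suc n) = G (u n)" for n by (simp add: u_def)
    have u_\<Phi>: "\<Phi> (u n)" for n
    proof (induction n)
      case 0 show ?case using \<Phi>_V by (simp add: u_def)
    next
      case (Suc n)
      show ?case using \<Phi>_convex[OF \<Phi>_bellman[OF Suc] \<Phi>_V t] by (simp add: u_Suc G_def[abs_def])
    qed
    \<comment> \<open>The ball of radius \<open>C / t\<close> is invariant, since (1 - t) (C + C /
      t) + t C = C / t.\<close>
    have G_bound: "\<bar>G W x\<bar> \<le> C / t" if "x \<in> S" "\<And>y. y \<in> S \<Longrightarrow> \<bar>W y\<bar> \<le> C / t" for W x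
    proof -
      have "\<bar>G W x\<bar> \<le> (1 - t) * \<bar>bellman W x\<bar> + t * \<bar>V x\<bar>"
        unfolding G_def using t by (intro order_trans[OF abs_triangle_ineq]) (simp add: abs_mult)
      also have "\<dots> \<le> (1 - t) * (C + C / t) + t * C"
        using t bellman_bound[OF that] CV[OF that(1)] by (intro add_mono mult_left_mono) auto
      also have "\<dots> = C / t" using t by (simp add: field_simps)
      finally show ?thesis .
    qed
    have u_bound: "\<bar>u n x\<bar> \<le> C / t" if "x \<in> S" for n x
      using that
    proof (induction n arbitrary: x)
      case 0
      have "C \<le> C / t" using t C1 by (simp add: le_divide_eq mult_left_le)
      then show ?case using CV[OF 0] by (simp add: u_def)
    next
      case (Suc n) then show ?case using G_bound[of x "u n"] by (simp add: u_Suc)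
    qed
    have G_contr: "\<bar>G W x - G W' x\<bar> \<le> (1 - t) * e"
      if "x \<in> S" "\<And>y. y \<in> S \<Longrightarrow> \<bar>W y - W' y\<bar> \<le> e" for W W' x e
    proof -
      have "\<bar>G W x - G W' x\<bar> = (1 - t) * \<bar>bellman W x - bellman W' x\<bar>"
        unfolding G_def using t by (simp add: abs_mult right_diff_distrib[symmetric])
      then show ?thesis using bellman_nonexpansive[OF that] t by (simp add: mult_left_mono)
    qed
    have u_diff: "\<bar>u (Suc n) x - u n x\<bar> \<le> (1 - t) ^ n * (2 * C / t)" if "x \<in> S" for n x
      using that
    proof (induction n arbitrary: x)
      case 0 show ?case using u_bound[OF 0, of 1] u_bound[OF 0, of 0] by simp
    next
      case (Suc n)
      have "\<bar>G (u (Suc n)) x - G (u n) x\<bar> \<le> (1 - t) * ((1 - t) ^ n * (2 * C / t))"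
        by (rule G_contr[OF Suc.prems Suc.IH])
      then show ?case by (simp add: u_Suc mult.assoc)
    qed
    have "(\<lambda>n. (1 - t) ^ n * (2 * C / t)) \<longlonglongrightarrow> 0 * (2 * C / t)"
      using t by (intro tendsto_mult_right LIMSEQ_power_zero) auto
    then have "eventually (\<lambda>n. (1 - t) ^ n * (2 * C / t) < t) sequentially"
      using t by (intro order_tendstoD(2)) auto
    then obtain n where n: "(1 - t) ^ n * (2 * C / t) < t" by (auto simp: eventually_sequentially)
    define h where "h = u n"
    have h_fix: "\<bar>G h x - h x\<bar> \<le> t" if "x \<in> S" for x
      using u_diff[OF that, of n] n by (simp add: h_def u_Suc)
    have th: "\<bar>t * h x\<bar> \<le> C" if "x \<in> S" for x
      using u_bound[OF that, of n] t by (simp add: h_def abs_mult field_simps)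
    have gap: "bellman h x - h x = t * bellman h x - t * V x + (G h x - h x)" for x
      by (simp add: G_def algebra_simps)
    have tV: "\<bar>t * V x\<bar> \<le> t * C" if "x \<in> S" for x
      using CV[OF that] t by (simp add: abs_mult)
    have tC: "t * C \<le> C" using t C1 by simp
    have res: "\<bar>bellman h x - h x\<bar> \<le> 4 * C" if x: "x \<in> S" for x
    proof -
      have "\<bar>t * bellman h x\<bar> \<le> t * (C + C / t)"
        using bellman_bound[OF x, of h "C / t"] u_bound t by (simp add: abs_mult h_def)
      also have "\<dots> = t * C + C" using t by (simp add: field_simps)
      finally show ?thesis using gap[of x] tV[OF x] h_fix[OF x] tC t C1 by linarith
    qed
    have span: "\<bar>h x - h y\<bar> \<le> K" if "x \<in> S" "y \<in> S" for x y using K[of h] res that by blast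
    \<comment> \<open>\<open>h\<close> itself may be of order \<open>C / t\<close>, but its span is
      at most \<open>K\<close>; after subtraction of \<open>h z\<close> a bounded function remains,
      and \<open>t * h z\<close> acts as the average cost.\<close>
    define w where "w x = h x + - h z" for x
    show ?thesis
    proof (intro exI[of _ w] exI[of _ "t * h z"] conjI ballI)
      show "\<Phi> w" using \<Phi>_const[OF u_\<Phi>, of n "- h z"] by (simp add: w_def[abs_def] h_def)
      show "\<bar>t * h z\<bar> \<le> C" by (rule th[OF z])
      fix x assume x: "x \<in> S"
      show "\<bar>w x\<bar> \<le> K" using span[OF x z] by (simp add: w_def)
      have "bellman w x - w x = bellman h x - h x"
        using bellman_add_const[OF x, of h "- h z"] by (simp add: w_def[abs_def])
      then have "bellman w x - (t * h z + w x) = t * (h x - h z) + t * (bellman h x - h x) - t * V x + (G h x - h x)"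
        using gap[of x] by (simp add: algebra_simps)
      moreover have "\<bar>t * (h x - h z)\<bar> \<le> t * K" using span[OF x z] t by (simp add: abs_mult)
      moreover have "\<bar>t * (bellman h x - h x)\<bar> \<le> t * (4 * C)" using res[OF x] t by (simp add: abs_mult)
      ultimately show "\<bar>bellman w x - (t * h z + w x)\<bar> \<le> t * (K + 5 * C + 1)"
        using tV[OF x] h_fix[OF x] unfolding distrib_left by linarith
    qed
  qed
  define tt where "tt n = 1 / real (Suc (Suc n))" for n
  have tt: "0 < tt n" "tt n < 1" for n by (auto simp: tt_def)
  obtain w \<rho> where w: "\<And>n. \<Phi> (w n)" "\<And>n. \<bar>\<rho> n\<bar> \<le> C" "\<And>n x. x \<in> S \<Longrightarrow> \<bar>w n x\<bar> \<le> K"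
      "\<And>n x. x \<in> S \<Longrightarrow> \<bar>bellman (w n) x - (\<rho> n + w n x)\<bar> \<le> tt n * (K + 5 * C + 1)"
    using approx[OF tt] by metis
  have "bounded (range (\<lambda>n. w n x))" if "x \<in> S" for x
    using w(3)[OF that] by (auto simp: bounded_iff)
  then obtain h r where r: "strict_mono (r :: nat \<Rightarrow> nat)" and h: "\<And>x. x \<in> S \<Longrightarrow> (\<lambda>n. w (r n) x) \<longlonglongrightarrow> h x"
    using finite_pointwise_subseq[OF finite_S, of w] by blast
  have tt_lim: "(\<lambda>n. tt (r n) * (K + 5 * C + 1)) \<longlonglongrightarrow> 0 * (K + 5 * C + 1)"
  proof (intro tendsto_mult_right)
    have "tt \<longlonglongrightarrow> 0" unfolding tt_def[abs_def]
      using LIMSEQ_subseq_LIMSEQ[OF lim_1_over_n, of "\<lambda>n. Suc (Suc n)"] by (simp add: o_def strict_mono_def)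
    then show "(\<lambda>n. tt (r n)) \<longlonglongrightarrow> 0" using LIMSEQ_subseq_LIMSEQ[OF _ r] by (simp add: o_def)
  qed
  have bell_lim: "(\<lambda>n. bellman (w (r n)) x) \<longlonglongrightarrow> bellman h x" if x: "x \<in> S" for x
  proof (rule LIMSEQ_I)
    fix e :: real assume e: "0 < e"
    have "eventually (\<lambda>n. \<forall>y\<in>S. dist (w (r n) y) (h y) < e / 2) sequentially"
      using finite_S h e by (intro eventually_ball_finite ballI tendstoD) auto
    then obtain N where N: "\<And>n y. n \<ge> N \<Longrightarrow> y \<in> S \<Longrightarrow> \<bar>w (r n) y - h y\<bar> < e / 2"
      by (auto simp: eventually_sequentially dist_real_def)
    have "\<bar>bellman (w (r n)) x - bellman h x\<bar> \<le> e / 2" if "n \<ge> N" for n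
      using N[OF that] by (intro bellman_nonexpansive[OF x]) (simp add: less_imp_le)
    then show "\<exists>no. \<forall>n\<ge>no. norm (bellman (w (r n)) x - bellman h x) < e" using e by (force intro!: exI[of _ N])
  qed
  define \<rho>' where "\<rho>' = bellman h z - h z"
  \<comment> \<open>The sequence on the left does not involve \<open>x\<close>, so its limit
    \<open>bellman h x - h x\<close> is the same for all \<open>x\<close>.\<close>
  have \<rho>_lim: "(\<lambda>n. \<rho> (r n)) \<longlonglongrightarrow> bellman h x - h x" if x: "x \<in> S" for x
  proof (rule Lim_transform)
    show "(\<lambda>n. bellman (w (r n)) x - w (r n) x) \<longlonglongrightarrow> bellman h x - h x"
      by (intro tendsto_diff bell_lim h x)
    show "(\<lambda>n. \<rho> (r n) - (bellman (w (r n)) x - w (r n) x)) \<longlonglongrightarrow> 0"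
    proof (rule Lim_null_comparison[OF always_eventually])
      show "\<forall>n. norm (\<rho> (r n) - (bellman (w (r n)) x - w (r n) x)) \<le> tt (r n) * (K + 5 * C + 1)"
      proof
        fix n show "norm (\<rho> (r n) - (bellman (w (r n)) x - w (r n) x)) \<le> tt (r n) * (K + 5 * C + 1)"
          using w(4)[OF x, of "r n"] unfolding real_norm_def by linarith
      qed
      show "(\<lambda>n. tt (r n) * (K + 5 * C + 1)) \<longlonglongrightarrow> 0" using tt_lim by simp
    qed
  qed
  have "bellman h x = \<rho>' + h x" if "x \<in> S" for x
    using LIMSEQ_unique[OF \<rho>_lim[OF that] \<rho>_lim[OF z]] by (simp add: \<rho>'_def)
  moreover have "\<Phi> h" using \<Phi>_lim[of "\<lambda>n. w (r n)" h] w(1) h by blast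
  ultimately show ?thesis by blast
qed


section \<open>Average cost of policies and optimality of greedy rules\<close>

definition admissible :: "(nat \<Rightarrow> 'x \<Rightarrow> 'a) \<Rightarrow> bool" where
  "admissible \<pi> \<longleftrightarrow> (\<forall>t. \<forall>x\<in>S. \<pi> t x \<in> Act x)"

lemma admissibleD: "admissible \<pi> \<Longrightarrow> x \<in> S \<Longrightarrow> \<pi> t x \<in> Act x"
  by (simp add: admissible_def)

definition run :: "(nat \<Rightarrow> 'x \<Rightarrow> 'a) \<Rightarrow> 'x \<Rightarrow> nat \<Rightarrow> 'x list pmf" where
  "run \<pi> = traj (\<lambda>t x. P x (\<pi> t x))"

definition total_cost :: "(nat \<Rightarrow> 'x \<Rightarrow> 'a) \<Rightarrow> 'x \<Rightarrow> nat \<Rightarrow> real" where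
  "total_cost \<pi> x T = measure_pmf.expectation (run \<pi> x T) (\<lambda>xs. \<Sum>t<T. c (xs ! t) (\<pi> t (xs ! t)))"

lemma run_support:
  assumes "admissible \<pi>" "x \<in> S"
  shows "set_pmf (run \<pi> x n) \<subseteq> {xs. set xs \<subseteq> S \<and> length xs = Suc n}"
proof (induction n)
  case 0
  show ?case using assms by (simp add: run_def)
next
  case (Suc n)
  show ?case
  proof
    fix xs assume "xs \<in> set_pmf (run \<pi> x (Suc n))"
    then obtain ys y where ys: "ys \<in> set_pmf (run \<pi> x n)" "y \<in> set_pmf (P (last ys) (\<pi> n (last ys)))" "xs = ys @ [y]"
      by (auto simp: run_def)
    have "set ys \<subseteq> S" "length ys = Suc n" using ys(1) Suc by auto
    moreover from calculation have "ys \<noteq> []" by auto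
    with calculation have "last ys \<in> S" using last_in_set by blast
    ultimately show "xs \<in> {xs. set xs \<subseteq> S \<and> length xs = Suc (Suc n)}"
      using ys P_closed[OF _ admissibleD[OF assms(1)], of "last ys" n] by auto
  qed
qed

lemma run_last_support:
  assumes adm: "admissible \<pi>" and x: "x \<in> S"
  shows "set_pmf (map_pmf last (run \<pi> x n)) \<subseteq> S"
proof
  fix y assume "y \<in> set_pmf (map_pmf last (run \<pi> x n))"
  then obtain xs where xs: "xs \<in> set_pmf (run \<pi> x n)" "y = last xs" by auto
  then have "set xs \<subseteq> S" "length xs = Suc n" using run_support[OF adm x] by blast+
  moreover from this have "xs \<noteq> []" by auto
  ultimately show "y \<in> S" using last_in_set xs(2) by blast
qed

text \<open>Later states are appended and leave entry \<open>t\<close> untouched; trajectory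
  expectations thus reduce to expectations under the law of a single state.\<close>

lemma run_nth:
  assumes adm: "admissible \<pi>" and x: "x \<in> S" and "t \<le> n"
  shows "map_pmf (\<lambda>xs. xs ! t) (run \<pi> x n) = map_pmf last (run \<pi> x t)"
  using \<open>t \<le> n\<close>
proof (induction n)
  case 0
  then show ?case by (simp add: run_def)
next
  case (Suc n)
  show ?case
  proof (cases "t = Suc n")
    case True
    have "xs ! t = last xs" if "xs \<in> set_pmf (run \<pi> x (Suc n))" for xs
    proof -
      have len: "length xs = Suc t" using that run_support[OF adm x, where n = "Suc n"] True by auto
      then have "xs \<noteq> []" by auto
      then show ?thesis using len by (simp add: last_conv_nth)
    qed
    then show ?thesis using True by (intro map_pmf_cong) auto
  next
    case False
    then have t: "t \<le> n" using Suc.prems by simp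
    have "map_pmf (\<lambda>xs. xs ! t) (run \<pi> x (Suc n)) =
        bind_pmf (run \<pi> x n) (\<lambda>xs. map_pmf (\<lambda>y. (xs @ [y]) ! t) (P (last xs) (\<pi> n (last xs))))"
      by (simp add: run_def map_bind_pmf map_pmf_comp)
    also have "\<dots> = bind_pmf (run \<pi> x n) (\<lambda>xs. return_pmf (xs ! t))"
    proof (rule bind_pmf_cong[OF refl])
      fix xs assume "xs \<in> set_pmf (run \<pi> x n)"
      then have "length xs = Suc n" using run_support[OF adm x] by blast
      then show "map_pmf (\<lambda>y. (xs @ [y]) ! t) (P (last xs) (\<pi> n (last xs))) = return_pmf (xs ! t)"
        using t by (simp add: nth_append map_pmf_const)
    qed
    also have "\<dots> = map_pmf last (run \<pi> x t)" using Suc.IH[OF t] by (simp add: map_pmf_def)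
    finally show ?thesis .
  qed
qed

lemma total_cost_eq:
  assumes adm: "admissible \<pi>" and x: "x \<in> S"
  shows "total_cost \<pi> x T =
    (\<Sum>t<T. measure_pmf.expectation (map_pmf last (run \<pi> x t)) (\<lambda>y. c y (\<pi> t y)))"
proof -
  have "finite {xs. set xs \<subseteq> S \<and> length xs = Suc T}" by (rule finite_lists_length_eq[OF finite_S])
  then have fin: "finite (set_pmf (run \<pi> x T))"
    using run_support[OF adm x] finite_subset by blast
  have "total_cost \<pi> x T = (\<Sum>t<T. measure_pmf.expectation (run \<pi> x T) (\<lambda>xs. c (xs ! t) (\<pi> t (xs ! t))))"
    unfolding total_cost_def by (rule Bochner_Integration.integral_sum) (rule integrable_measure_pmf_finite[OF fin])
  also have "\<dots> = (\<Sum>t<T. measure_pmf.expectation (map_pmf (\<lambda>xs. xs ! t) (run \<pi> x T)) (\<lambda>y. c y (\<pi> t y)))"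
    by simp
  also have "\<dots> = (\<Sum>t<T. measure_pmf.expectation (map_pmf last (run \<pi> x t)) (\<lambda>y. c y (\<pi> t y)))"
    by (intro sum.cong refl) (simp only: run_nth[OF adm x] less_imp_le lessThan_iff)
  finally show ?thesis .
qed

text \<open>Along any run, \<open>h\<close> is a potential: the increments \<open>Q h - h \<ge> \<rho>\<close> telescope.\<close>

lemma total_cost_potential:
  assumes adm: "admissible \<pi>" and x: "x \<in> S"
  shows "total_cost \<pi> x T + measure_pmf.expectation (map_pmf last (run \<pi> x T)) h - h x =
    (\<Sum>t<T. measure_pmf.expectation (map_pmf last (run \<pi> x t)) (\<lambda>y. Q h y (\<pi> t y) - h y))"
proof -
  define m where "m t = map_pmf last (run \<pi> x t)" for t
  have m_S: "set_pmf (m t) \<subseteq> S" for t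
    unfolding m_def by (rule run_last_support[OF adm x])
  have int: "integrable (measure_pmf (m t)) f" for t and f :: "'x \<Rightarrow> real"
    using m_S finite_S finite_subset by (intro integrable_measure_pmf_finite) blast
  have m_Suc: "m (Suc t) = bind_pmf (m t) (\<lambda>y. P y (\<pi> t y))" for t
    by (simp add: m_def run_def map_bind_pmf bind_map_pmf map_pmf_comp o_def)
  have fin: "finite (set_pmf (P y (\<pi> t y)))" if "y \<in> S" for t y
    using P_closed[OF that admissibleD[OF adm that]] finite_S finite_subset by blast
  have exp_Suc: "measure_pmf.expectation (m (Suc t)) h =
      measure_pmf.expectation (m t) (\<lambda>y. measure_pmf.expectation (P y (\<pi> t y)) h)" for t
  proof -
    have "measure_pmf.expectation (m (Suc t)) h =
        (\<Sum>y\<in>S. pmf (m t) y *\<^sub>R measure_pmf.expectation (P y (\<pi> t y)) h)"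
      unfolding m_Suc by (rule pmf_expectation_bind[OF finite_S fin m_S])
    also have "\<dots> = measure_pmf.expectation (m t) (\<lambda>y. measure_pmf.expectation (P y (\<pi> t y)) h)"
      using m_S by (intro integral_measure_pmf[OF finite_S, symmetric]) auto
    finally show ?thesis .
  qed
  have step: "measure_pmf.expectation (m t) (\<lambda>y. Q h y (\<pi> t y) - h y) =
      measure_pmf.expectation (m t) (\<lambda>y. c y (\<pi> t y)) +
      (measure_pmf.expectation (m (Suc t)) h - measure_pmf.expectation (m t) h)" for t
    unfolding Q_def exp_Suc using int by simp
  have "measure_pmf.expectation (m 0) h = h x" by (simp add: m_def run_def)
  then have "total_cost \<pi> x T + measure_pmf.expectation (m T) h - h x =
      (\<Sum>t<T. measure_pmf.expectation (m t) (\<lambda>y. c y (\<pi> t y))) +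
      (\<Sum>t<T. measure_pmf.expectation (m (Suc t)) h - measure_pmf.expectation (m t) h)"
    unfolding total_cost_eq[OF adm x] m_def[symmetric]
      sum_lessThan_telescope[of "\<lambda>t. measure_pmf.expectation (m t) h"] by simp
  also have "\<dots> = (\<Sum>t<T. measure_pmf.expectation (m t) (\<lambda>y. Q h y (\<pi> t y) - h y))"
    unfolding step by (rule sum.distrib[symmetric])
  finally show ?thesis by (simp add: m_def)
qed

text \<open>The increments in the telescoped sum are at least \<open>\<rho>\<close> for every
  admissible policy and equal to \<open>\<rho>\<close> for greedy ones. The error consists of the
  values of \<open>h\<close> at the start and at the horizon, each bounded by the maximum of
  |\<open>h\<close>|.\<close>

lemma total_cost_bounds:
  assumes acoe: "\<And>y. y \<in> S \<Longrightarrow> bellman h y = \<rho> + h y"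
  shows "\<exists>H. \<forall>\<pi> x T. admissible \<pi> \<longrightarrow> x \<in> S \<longrightarrow>
     real T * \<rho> - H \<le> total_cost \<pi> x T \<and>
     ((\<forall>t. \<forall>y\<in>S. Q h y (\<pi> t y) = bellman h y) \<longrightarrow> total_cost \<pi> x T \<le> real T * \<rho> + H)"
proof -
  define H where "H = Max ((\<lambda>y. \<bar>h y\<bar>) ` S)"
  have H: "\<bar>h y\<bar> \<le> H" if "y \<in> S" for y using that finite_S by (simp add: H_def)
  show ?thesis
  proof (intro exI[of _ "2 * H"] allI impI)
    fix \<pi> x T assume adm: "admissible \<pi>" and x: "x \<in> S"
    define m where "m t = map_pmf last (run \<pi> x t)" for t
    have m_S: "set_pmf (m t) \<subseteq> S" for t
      unfolding m_def by (rule run_last_support[OF adm x])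
    have int: "integrable (measure_pmf (m t)) f" for t and f :: "'x \<Rightarrow> real"
      using m_S finite_S finite_subset by (intro integrable_measure_pmf_finite) blast
    have ge: "b \<le> measure_pmf.expectation (m t) f" if "\<And>y. y \<in> S \<Longrightarrow> b \<le> f y" for b t and f :: "'x \<Rightarrow> real"
      using m_S[of t] that by (intro measure_pmf.integral_ge_const int) (auto simp: AE_measure_pmf_iff)
    have le: "measure_pmf.expectation (m t) f \<le> b" if "\<And>y. y \<in> S \<Longrightarrow> f y \<le> b" for b t and f :: "'x \<Rightarrow> real"
      using m_S[of t] that by (intro measure_pmf.integral_le_const int) (auto simp: AE_measure_pmf_iff)
    have eq: "total_cost \<pi> x T + measure_pmf.expectation (m T) h - h x =
      (\<Sum>t<T. measure_pmf.expectation (m t) (\<lambda>y. Q h y (\<pi> t y) - h y))"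
      using total_cost_potential[OF adm x] by (simp add: m_def)
    have hb: "- H \<le> h y" "h y \<le> H" if "y \<in> S" for y using H[OF that] by linarith+
    have hT: "- H \<le> measure_pmf.expectation (m T) h" "measure_pmf.expectation (m T) h \<le> H"
      by (rule ge[OF hb(1)], assumption) (rule le[OF hb(2)], assumption)
    have Qh: "\<rho> \<le> Q h y (\<pi> t y) - h y" if "y \<in> S" for y t
      using bellman_le[OF that admissibleD[OF adm that], of h] acoe[OF that] by (simp add: algebra_simps)
    have "(\<Sum>t<T. \<rho>) \<le> (\<Sum>t<T. measure_pmf.expectation (m t) (\<lambda>y. Q h y (\<pi> t y) - h y))"
      by (intro sum_mono ge Qh)
    then have lower: "real T * \<rho> - 2 * H \<le> total_cost \<pi> x T" using eq hT hb[OF x] by simp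
    moreover have "total_cost \<pi> x T \<le> real T * \<rho> + 2 * H"
      if greedy: "\<forall>t. \<forall>y\<in>S. Q h y (\<pi> t y) = bellman h y"
    proof -
      have "(\<Sum>t<T. measure_pmf.expectation (m t) (\<lambda>y. Q h y (\<pi> t y) - h y)) \<le> (\<Sum>t<T. \<rho>)"
        using greedy acoe by (intro sum_mono le) auto
      then show ?thesis using eq hT hb[OF x] by simp
    qed
    ultimately show "real T * \<rho> - 2 * H \<le> total_cost \<pi> x T \<and>
     ((\<forall>t. \<forall>y\<in>S. Q h y (\<pi> t y) = bellman h y) \<longrightarrow> total_cost \<pi> x T \<le> real T * \<rho> + 2 * H)" by blast
  qed
qed

lemma greedy_optimal:
  assumes acoe: "\<And>y. y \<in> S \<Longrightarrow> bellman h y = \<rho> + h y"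
    and \<mu>: "\<And>y. y \<in> S \<Longrightarrow> \<mu> y \<in> Act y" "\<And>y. y \<in> S \<Longrightarrow> Q h y (\<mu> y) = bellman h y"
    and \<pi>: "admissible \<pi>" and x: "x \<in> S"
  shows "limsup (\<lambda>T. ereal (1 / real T * total_cost (\<lambda>_. \<mu>) x T))
    \<le> limsup (\<lambda>T. ereal (1 / real T * total_cost \<pi> x T))"
proof -
  have "admissible (\<lambda>_. \<mu>)" using \<mu>(1) by (simp add: admissible_def)
  then obtain H where lo: "\<And>T. real T * \<rho> - H \<le> total_cost \<pi> x T"
    and hi: "\<And>T. total_cost (\<lambda>_. \<mu>) x T \<le> real T * \<rho> + H"
    using total_cost_bounds[of h \<rho>, OF acoe] \<pi> \<mu>(2) x by metis
  have lim: "(\<lambda>T. \<rho> + b / real T) \<longlonglongrightarrow> \<rho>" for b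
    using tendsto_add[OF tendsto_const lim_const_over_n[of b], of \<rho>] by simp
  have "limsup (\<lambda>T. ereal (1 / real T * total_cost (\<lambda>_. \<mu>) x T)) \<le> limsup (\<lambda>T. ereal (\<rho> + H / real T))"
  \<comment> \<open>Horizon 0 is excluded: there division by zero gives 0, and the comparison could
    fail for negative \<open>\<rho>\<close>.\<close>
  proof (rule Limsup_mono, rule eventually_sequentiallyI[of 1])
    fix T :: nat assume "1 \<le> T"
    have "1 / real T * total_cost (\<lambda>_. \<mu>) x T \<le> 1 / real T * (real T * \<rho> + H)"
      using hi[of T] by (intro mult_left_mono) auto
    moreover have "1 / real T * (real T * \<rho> + H) = \<rho> + H / real T"
      using \<open>1 \<le> T\<close> by (simp add: field_simps)
    ultimately show "ereal (1 / real T * total_cost (\<lambda>_. \<mu>) x T) \<le> ereal (\<rho> + H / real T)" by simp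
  qed
  also have "\<dots> = ereal \<rho>" using lim by (intro lim_imp_Limsup) auto
  also have "\<dots> = limsup (\<lambda>T. ereal (\<rho> + (- H) / real T))" using lim by (intro lim_imp_Limsup[symmetric]) (auto simp del: divide_minus_left)
  also have "\<dots> \<le> limsup (\<lambda>T. ereal (1 / real T * total_cost \<pi> x T))"
  proof (rule Limsup_mono, rule eventually_sequentiallyI[of 1])
    fix T :: nat assume "1 \<le> T"
    have "1 / real T * (real T * \<rho> - H) \<le> 1 / real T * total_cost \<pi> x T"
      using lo[of T] by (intro mult_left_mono) auto
    moreover have "1 / real T * (real T * \<rho> - H) = \<rho> + (- H) / real T"
      using \<open>1 \<le> T\<close> by (simp add: field_simps)
    ultimately show "ereal (\<rho> + (- H) / real T) \<le> ereal (1 / real T * total_cost \<pi> x T)" by simp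
  qed
  finally show ?thesis .
qed

end

section \<open>Reachability in finite Markov chains\<close>

text \<open>The gcd condition produces two consecutive elements, whose nonnegative combinations
  contain all large numbers.\<close>

lemma numerical_semigroup_cofinite:
  fixes A :: "nat set"
  assumes zero: "0 \<in> A" and add: "\<And>a b. a \<in> A \<Longrightarrow> b \<in> A \<Longrightarrow> a + b \<in> A"
    and Gcd: "Gcd {n. n > 0 \<and> n \<in> A} = 1"
  shows "\<exists>n0. \<forall>n\<ge>n0. n \<in> A"
proof -
  have mult: "k * a \<in> A" if "a \<in> A" for k a
    by (induction k) (use zero add that in auto)
  have "\<exists>n>0. n \<in> A"
  proof (rule ccontr)
    assume "\<not> ?thesis"
    then have "{n. n > 0 \<and> n \<in> A} = {}" by auto
    then show False using Gcd by (metis Gcd_empty zero_neq_one)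
  qed
  then have ex: "\<exists>d>0. \<exists>b\<in>A. b + d \<in> A" using zero by (metis add_0)
  \<comment> \<open>The least positive difference of two elements divides every element.\<close>
  define \<delta> where "\<delta> = (LEAST d. d > 0 \<and> (\<exists>b\<in>A. b + d \<in> A))"
  have \<delta>: "\<delta> > 0 \<and> (\<exists>b\<in>A. b + \<delta> \<in> A)" unfolding \<delta>_def using ex by (rule LeastI_ex)
  then obtain b where b: "b \<in> A" "b + \<delta> \<in> A" by auto
  have least: "\<not> (d > 0 \<and> (\<exists>b\<in>A. b + d \<in> A))" if "d < \<delta>" for d
    using that unfolding \<delta>_def by (rule not_less_Least)
  have dvd: "\<delta> dvd r" if r: "r \<in> A" for r
  proof -
    \<comment> \<open>Its left side and \<open>(r div \<delta>) * (b + \<delta>)\<close> both lie in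
      \<open>A\<close>; their difference \<open>r mod \<delta>\<close> is below the least positive
      one, hence 0.\<close>
    have "r + (r div \<delta>) * b = (r div \<delta>) * (b + \<delta>) + r mod \<delta>"
      by (simp add: distrib_left algebra_simps)
    then have "(r div \<delta>) * (b + \<delta>) + r mod \<delta> \<in> A" using add[OF r mult[OF b(1)]] by metis
    moreover have "(r div \<delta>) * (b + \<delta>) \<in> A" by (rule mult[OF b(2)])
    moreover have "r mod \<delta> < \<delta>" using \<delta> by simp
    ultimately have "r mod \<delta> = 0" using least[of "r mod \<delta>"] by (metis gr0I)
    then show ?thesis by (rule mod_0_imp_dvd)
  qed
  have "\<delta> dvd Gcd {n. n > 0 \<and> n \<in> A}"
    by (rule Gcd_greatest, rule dvd) blast
  then have \<delta>1: "\<delta> = 1" unfolding Gcd nat_dvd_1_iff_1 .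
  \<comment> \<open>Among the \<open>q\<close> copies of \<open>b\<close> in n = q b + r,
    \<open>r\<close> copies are replaced by b + 1; this needs r \<le> q, which the bound on
    \<open>n\<close> ensures.\<close>
  have "n \<in> A" if n: "n \<ge> b * b" for n
  proof (cases "b = 0")
    case True
    then show ?thesis using mult[of 1 n] b \<delta>1 by simp
  next
    case False
    define q r where "q = n div b" and "r = n mod b"
    have "b \<le> q" using n False by (simp add: q_def less_eq_div_iff_mult_less_eq)
    moreover have "r < b" using False by (simp add: r_def)
    ultimately have qr: "q = (q - r) + r" by simp
    have "n = q * b + r" by (simp add: q_def r_def)
    also have "\<dots> = (q - r) * b + r * (b + 1)" by (subst qr) (simp add: algebra_simps)
    also have "\<dots> \<in> A" using add[OF mult[OF b(1)] mult[OF b(2)]] \<delta>1 by simp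
    finally show ?thesis .
  qed
  then show ?thesis by blast
qed

definition supp :: "('x \<Rightarrow> 'x pmf) \<Rightarrow> ('x \<times> 'x) set" where
  "supp P = {(x, y). y \<in> set_pmf (P x)}"

lemma map_last_traj_Suc:
  "map_pmf last (traj K x (Suc n)) = bind_pmf (map_pmf last (traj K x n)) (K n)"
  by (simp add: map_bind_pmf bind_map_pmf map_pmf_comp o_def)

lemma set_nstep: "y \<in> set_pmf (nstep P n x) \<longleftrightarrow> (x, y) \<in> supp P ^^ n"
proof (induction n arbitrary: y)
  case 0
  show ?case by (auto simp: nstep_def)
next
  case (Suc n)
  have "nstep P (Suc n) x = bind_pmf (nstep P n x) P"
    unfolding nstep_def by (rule map_last_traj_Suc)
  then show ?case using Suc by (auto simp: supp_def)
qed

text \<open>A visit within \<open>n\<close> steps becomes a path of exact length, which can be run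
  in step with a demand path.\<close>

lemma traj_visits:
  assumes "ss \<in> set_pmf (traj (\<lambda>_. P) s n)" "y \<in> set ss"
  shows "\<exists>k\<le>n. (s, y) \<in> supp P ^^ k"
  using assms
proof (induction n arbitrary: ss)
  case 0
  then show ?case by (auto intro!: exI[of _ 0])
next
  case (Suc n)
  then obtain ss' z where ss': "ss' \<in> set_pmf (traj (\<lambda>_. P) s n)" "z \<in> set_pmf (P (last ss'))" "ss = ss' @ [z]"
    by auto
  show ?case
  proof (cases "y \<in> set ss'")
    case True
    then show ?thesis using Suc.IH[OF ss'(1)] le_SucI by blast
  next
    case False
    have "last ss' \<in> set_pmf (nstep P n s)" using ss'(1) by (auto simp: nstep_def)
    then have "(s, z) \<in> supp P ^^ Suc n" using ss'(2) by (auto simp: set_nstep supp_def)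
    moreover have "y = z" using False ss'(3) Suc.prems by auto
    ultimately show ?thesis by blast
  qed
qed

text \<open>Return times to \<open>y\<close> form an additive set with gcd 1, so all large numbers
  are return times; one path from \<open>x\<close> to \<open>y\<close> is put in front.\<close>

lemma ergodic_eventually_reaches:
  assumes "ergodic_chain P"
  shows "\<exists>n0. \<forall>n\<ge>n0. (x, y) \<in> supp P ^^ n"
proof -
  define A where "A = {n. (y, y) \<in> supp P ^^ n}"
  have irr: "\<exists>n. (x, y) \<in> supp P ^^ n"
    using assms unfolding ergodic_chain_def irreducible_chain_def
    by (metis pmf_positive_iff set_nstep)
  have "{n. n > 0 \<and> n \<in> A} = {n. n > 0 \<and> pmf (nstep P n y) y > 0}"
    by (simp add: A_def flip: set_nstep pmf_positive_iff)
  then have "Gcd {n. n > 0 \<and> n \<in> A} = 1"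
    using assms by (simp add: ergodic_chain_def aperiodic_chain_def)
  moreover have "a + b \<in> A" if "a \<in> A" "b \<in> A" for a b
    using that relcompI unfolding A_def relpow_add mem_Collect_eq by fast
  moreover have "0 \<in> A" by (simp add: A_def)
  ultimately have "\<exists>n0. \<forall>n\<ge>n0. n \<in> A" by (intro numerical_semigroup_cofinite)
  then obtain n0 where n0: "\<And>n. n \<ge> n0 \<Longrightarrow> n \<in> A" by blast
  obtain k where k: "(x, y) \<in> supp P ^^ k" using irr by blast
  have "(x, y) \<in> supp P ^^ n" if "n \<ge> k + n0" for n
  proof -
    have "(y, y) \<in> supp P ^^ (n - k)" using n0[of "n - k"] that by (simp add: A_def)
    then have "(x, y) \<in> supp P ^^ (k + (n - k))" using k unfolding relpow_add by (rule relcompI[rotated])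
    then show ?thesis using that by simp
  qed
  then show ?thesis by blast
qed

section \<open>Monotonicity of the Bellman operator\<close>

definition raise :: "('c \<Rightarrow> vehicle) \<Rightarrow> 'c \<Rightarrow> 'c \<Rightarrow> vehicle" where
  "raise v i = v(i := (fst (v i), Suc (snd (v i))))"

definition charge :: "('c \<Rightarrow> vehicle) \<Rightarrow> 'c action \<Rightarrow> 'c \<Rightarrow> vehicle" where
  "charge v a = (\<lambda>i. (fst (v i), snd (v i) - a i))"

definition advance :: "('c \<Rightarrow> vehicle) \<Rightarrow> vehicle list \<Rightarrow> ('c \<Rightarrow> nat option) \<Rightarrow> 'c \<Rightarrow> vehicle" where
  "advance v as \<sigma> i =
     (if fst (v i) \<ge> 2 then (fst (v i) - 1, snd (v i))
      else case \<sigma> i of Some k \<Rightarrow> as ! k | None \<Rightarrow> (0, 0))"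

text \<open>This law sees the vehicles only through their remaining stages and the action only
  through its aggregate, so configurations agreeing in both can be compared outcome by
  outcome.\<close>

definition noise ::
    "('c::finite, 's::finite, 'd::finite) phev \<Rightarrow> ('c \<Rightarrow> nat) \<Rightarrow> 's \<Rightarrow> 'd \<Rightarrow> nat
       \<Rightarrow> ('s \<times> 'd \<times> vehicle list \<times> ('c \<Rightarrow> nat option)) pmf" where
  "noise M l s d A =
     bind_pmf (grid M s A) (\<lambda>s'. bind_pmf (demand M d) (\<lambda>(d', as).
       map_pmf (\<lambda>\<sigma>. (s', d', as, \<sigma>)) (assign M d (\<lambda>i. l i - 1) as)))"

definition valid_vehicles :: "('c, 's, 'd) phev \<Rightarrow> ('c \<Rightarrow> vehicle) \<Rightarrow> bool" where
  "valid_vehicles M v \<longleftrightarrow> (\<forall>i. v i = (0, 0) \<or> v i \<in> vehicle_states M)"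

definition departure_cost :: "('c::finite, 's, 'd) phev \<Rightarrow> ('c \<Rightarrow> vehicle) \<Rightarrow> real" where
  "departure_cost M v = (\<Sum>j | fst (v j) = 1. penalty M (snd (v j)))"

text \<open>The one-stage cost plus continuation value as a function of the vehicle states \<^emph>\<open>after\<close>
  charging, so that a change of action and a change of state can be compared with each other.\<close>

definition post_cost ::
    "('c::finite, 's::finite, 'd::finite) phev \<Rightarrow> (('c, 's, 'd) sys_state \<Rightarrow> real)
       \<Rightarrow> ('c \<Rightarrow> vehicle) \<Rightarrow> 's \<Rightarrow> 'd \<Rightarrow> nat \<Rightarrow> real" where
  "post_cost M W v s d A = charge_cost M A s + departure_cost M v +
     measure_pmf.expectation (noise M (\<lambda>i. fst (v i)) s d A)
       (\<lambda>(s', d', as, \<sigma>). W (advance v as \<sigma>, s', d'))"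

lemma raise_simps [simp]:
  "fst (raise v i k) = fst (v k)"
  "snd (raise v i k) = (if k = i then Suc (snd (v k)) else snd (v k))"
  by (auto simp: raise_def)

lemma charge_simps [simp]:
  "fst (charge v a k) = fst (v k)" "snd (charge v a k) = snd (v k) - a k"
  by (auto simp: charge_def)

text \<open>The hypothesis prevents truncated subtraction from absorbing the added unit.\<close>

lemma charge_raise: "a i \<le> snd (v i) \<Longrightarrow> charge (raise v i) a = raise (charge v a) i"
  by (auto simp: fun_eq_iff prod_eq_iff Suc_diff_le)

text \<open>A departing vehicle takes its extra unit along; the difference then survives only in the
  departure cost.\<close>

lemma advance_raise:
  "advance (raise v i) as \<sigma> = (if fst (v i) \<ge> 2 then raise (advance v as \<sigma>) i else advance v as \<sigma>)"
  by (auto simp: fun_eq_iff advance_def raise_def)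

lemma departure_cost_raise:
  "departure_cost M (raise v i) = departure_cost M v +
     (if fst (v i) = 1 then penalty M (Suc (snd (v i))) - penalty M (snd (v i)) else 0)"
proof (cases "fst (v i) = 1")
  case True
  have split: "(\<Sum>j | fst (v j) = 1. f j) = f i + (\<Sum>j\<in>{j. fst (v j) = 1} - {i}. f j)" for f :: "_ \<Rightarrow> real"
    using True by (intro sum.remove) auto
  have "(\<Sum>j\<in>{j. fst (v j) = 1} - {i}. penalty M (snd (raise v i j)))
      = (\<Sum>j\<in>{j. fst (v j) = 1} - {i}. penalty M (snd (v j)))"
    by (rule sum.cong) auto
  then show ?thesis using True unfolding departure_cost_def raise_simps(1) split by simp
next
  case False
  then show ?thesis unfolding departure_cost_def by (auto intro!: sum.cong)
qed

lemma aggregate_eq: "aggregate (v, s, d) a = (\<Sum>k | fst (v k) \<ge> 1. a k)"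
  by (simp add: aggregate_def connected_chargers_def lam_def)

lemma aggregate_swap:
  fixes a :: "'c::finite action"
  assumes "fst (v i) \<ge> 1" "fst (v j) \<ge> 1" "i \<noteq> j"
  shows "aggregate (v, s, d) (a(i := a j, j := a i)) = aggregate (v, s, d) a"
proof -
  let ?R = "{k. fst (v k) \<ge> 1} - {i} - {j}"
  have split: "aggregate (v, s, d) b = b i + (b j + sum b ?R)" for b
    unfolding aggregate_eq using assms by (subst sum.remove[of _ i], simp, simp, subst sum.remove[of _ j]) auto
  have "sum (a(i := a j, j := a i)) ?R = sum a ?R" by (rule sum.cong) auto
  then show ?thesis unfolding split using assms(3) by simp
qed

lemma valid_charge:
  assumes "valid_vehicles M v"
  shows "valid_vehicles M (charge v a)"
  unfolding valid_vehicles_def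
proof
  fix k
  show "charge v a k = (0, 0) \<or> charge v a k \<in> vehicle_states M"
    using assms[unfolded valid_vehicles_def, rule_format, of k]
    by (cases "v k") (auto simp: charge_def vehicle_states_def)
qed

lemma valid_unraise: "valid_vehicles M (raise v i) \<Longrightarrow> valid_vehicles M v" if "fst (v i) \<ge> 1"
proof -
  assume ok: "valid_vehicles M (raise v i)"
  have "v k = (0, 0) \<or> v k \<in> vehicle_states M" for k
    using ok[unfolded valid_vehicles_def, rule_format, of k] that
    by (cases "v k") (auto simp: raise_def vehicle_states_def split: if_splits)
  then show ?thesis by (auto simp: valid_vehicles_def)
qed

lemma sys_states_iff: "(v, s, d) \<in> sys_states M \<longleftrightarrow> valid_vehicles M v"
  by (simp add: sys_states_def valid_vehicles_def)

lemma feasible_iff: "feasible_action (v, s, d) a \<longleftrightarrow> (\<forall>i. a i \<in> {0, 1} \<and> a i \<le> snd (v i))"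
  by (simp add: feasible_action_def gam_def)

lemma finite_funs_into:
  fixes F :: "'b set"
  assumes "finite F"
  shows "finite {f :: 'c::finite \<Rightarrow> 'b. \<forall>i. f i \<in> F}"
proof -
  have "{f :: 'c \<Rightarrow> 'b. \<forall>i. f i \<in> F} = PiE UNIV (\<lambda>_. F)" by (auto simp: PiE_UNIV_domain)
  then show ?thesis using finite_PiE[of "UNIV :: 'c set" "\<lambda>_. F"] assms by simp
qed

lemma finite_sys_states: "finite (sys_states (M :: ('c::finite, 's::finite, 'd::finite) phev))"
proof -
  have "sys_states M = {v. \<forall>i. v i \<in> insert (0, 0) (vehicle_states M)} \<times> UNIV"
    by (auto simp: sys_states_def)
  moreover have "finite (insert (0, 0) (vehicle_states M))" by (simp add: vehicle_states_def)
  ultimately show ?thesis by (simp only: finite_cartesian_product[OF finite_funs_into] finite)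
qed

lemma finite_feasible: "finite {a. feasible_action (x :: ('c::finite, 's::finite, 'd::finite) sys_state) a}"
  by (rule finite_subset[OF _ finite_funs_into[of "{0, 1}"]]) (auto simp: feasible_action_def)

lemma feasible_zero: "feasible_action x (\<lambda>_. 0)"
  by (simp add: feasible_action_def)

lemma transition_eq_noise:
  "transition M (v, s, d) a =
     map_pmf (\<lambda>(s', d', as, \<sigma>). (advance (charge v a) as \<sigma>, s', d'))
       (noise M (\<lambda>i. fst (v i)) s d (aggregate (v, s, d) a))"
proof -
  have "next_vehicles (v, s, d) a as \<sigma> = advance (charge v a) as \<sigma>" for as \<sigma>
    by (auto simp: fun_eq_iff next_vehicles_def advance_def lam_def gam_def)
  then show ?thesis
    by (simp add: transition_def noise_def map_bind_pmf lam_def case_prod_unfold map_pmf_comp)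
       (simp add: map_pmf_def)
qed

lemma stage_cost_plus_expectation:
  "stage_cost M (v, s, d) a + measure_pmf.expectation (transition M (v, s, d) a) W =
     post_cost M W (charge v a) s d (aggregate (v, s, d) a)"
proof -
  have "departing (v, s, d) = {j. fst (v j) = 1}"
    by (auto simp: departing_def connected_chargers_def lam_def)
  then show ?thesis
    by (simp add: stage_cost_def post_cost_def departure_cost_def transition_eq_noise gam_def case_prod_unfold)
qed

lemma noise_valid:
  assumes "phev_model M" "(s', d', as, \<sigma>) \<in> set_pmf (noise M l s d A)" "valid_vehicles M v"
  shows "valid_vehicles M (advance v as \<sigma>)"
proof -
  have as: "set as \<subseteq> vehicle_states M" and \<sigma>: "ran \<sigma> \<subseteq> {..<length as}"
    using assms(1,2) unfolding phev_model_def noise_def by fastforce+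
  have "advance v as \<sigma> i = (0, 0) \<or> advance v as \<sigma> i \<in> vehicle_states M" for i
  proof (cases "fst (v i) \<ge> 2")
    case True
    then show ?thesis using assms(3)[unfolded valid_vehicles_def, rule_format, of i]
      by (cases "v i") (auto simp: advance_def vehicle_states_def)
  next
    case False
    then show ?thesis using as \<sigma> by (auto simp: advance_def ran_def split: option.split intro!: nth_mem subsetD[OF as])
  qed
  then show ?thesis by (simp add: valid_vehicles_def)
qed

lemma transition_closed:
  assumes "phev_model M" "x \<in> sys_states M"
  shows "set_pmf (transition M x a) \<subseteq> sys_states M"
proof -
  obtain v s d where x: "x = (v, s, d)" by (cases x)
  show ?thesis using assms(2) noise_valid[OF assms(1) _ valid_charge]
    by (auto simp: x transition_eq_noise sys_states_iff)
qed

text \<open>Arrival lists have no bounded length, so the noise may have infinite support; what is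
  finite is the set of values of \<open>W\<close> on system states.\<close>

lemma expectation_le_add_of_finite_range:
  fixes f g :: "'w \<Rightarrow> real"
  assumes "finite (f ` set_pmf p)" "finite (g ` set_pmf p)" "\<And>w. w \<in> set_pmf p \<Longrightarrow> f w \<le> g w + e"
  shows "measure_pmf.expectation p f \<le> measure_pmf.expectation p g + e"
proof -
  have int: "integrable (measure_pmf p) h" if h: "finite (h ` set_pmf p)" for h :: "'w \<Rightarrow> real"
  proof -
    obtain B where "\<forall>y\<in>h ` set_pmf p. norm y \<le> B"
      using finite_imp_bounded[OF h] unfolding bounded_iff by blast
    then show ?thesis by (intro measure_pmf.integrable_const_bound[of _ B]) (auto simp: AE_measure_pmf_iff)
  qed
  have "measure_pmf.expectation p f \<le> measure_pmf.expectation p (\<lambda>w. g w + e)"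
    using int[OF assms(1)] int[OF assms(2)] assms(3)
    by (intro integral_mono_AE) (auto simp: AE_measure_pmf_iff)
  also have "\<dots> = measure_pmf.expectation p g + e" using int[OF assms(2)] by simp
  finally show ?thesis .
qed

lemma noise_expectation_le_add:
  fixes M :: "('c::finite, 's::finite, 'd::finite) phev" and W :: "('c, 's, 'd) sys_state \<Rightarrow> real"
  assumes "phev_model M" "valid_vehicles M v" "valid_vehicles M v'"
    and "\<And>s' d' as \<sigma>. valid_vehicles M (advance v as \<sigma>) \<Longrightarrow> valid_vehicles M (advance v' as \<sigma>) \<Longrightarrow>
      W (advance v as \<sigma>, s', d') \<le> W (advance v' as \<sigma>, s', d') + e"
  shows "measure_pmf.expectation (noise M l s d A) (\<lambda>(s', d', as, \<sigma>). W (advance v as \<sigma>, s', d'))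
    \<le> measure_pmf.expectation (noise M l s d A) (\<lambda>(s', d', as, \<sigma>). W (advance v' as \<sigma>, s', d')) + e"
proof -
  define F where "F v = (\<lambda>(s' :: 's, d' :: 'd, as, \<sigma>). W (advance v as \<sigma>, s', d'))" for v :: "'c \<Rightarrow> vehicle"
  have "F v ` set_pmf (noise M l s d A) \<subseteq> W ` sys_states M" if v: "valid_vehicles M v" for v
    using noise_valid[OF assms(1) _ v] by (auto simp: F_def sys_states_iff intro!: imageI)
  then have "finite (F v ` set_pmf (noise M l s d A))" if "valid_vehicles M v" for v
    using that finite_subset finite_imageI[OF finite_sys_states[of M], of W] by blast
  then have "measure_pmf.expectation (noise M l s d A) (F v) \<le> measure_pmf.expectation (noise M l s d A) (F v') + e"
    using noise_valid[OF assms(1)] assms(2-)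
    by (intro expectation_le_add_of_finite_range) (auto simp: F_def)
  then show ?thesis by (simp add: F_def)
qed


section \<open>Regular functions\<close>

definition increment :: "('c, 's, 'd) phev \<Rightarrow> nat \<Rightarrow> real" where
  "increment M n = penalty M (Suc n) - penalty M n"

text \<open>The third clause compares states after a unit of work is moved between two vehicles: there \<open>v\<close>
  is the common lower bound, and the side conditions say that, after the raise, \<open>i\<close> has at most the
  work and at least the laxity of \<open>j\<close>.\<close>

definition regular :: "('c::finite, 's::finite, 'd::finite) phev \<Rightarrow> (('c, 's, 'd) sys_state \<Rightarrow> real) \<Rightarrow> bool" where
  "regular M W \<longleftrightarrow>
     (\<forall>v s d i. valid_vehicles M (raise v i) \<longrightarrow> fst (v i) \<ge> 1 \<longrightarrow>
        W (raise v i, s, d) \<le> W (v, s, d) + increment M (snd (v i))) \<and>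
     (\<forall>v s d i. valid_vehicles M (raise v i) \<longrightarrow> fst (v i) \<ge> 1 \<longrightarrow> fst (v i) \<le> snd (v i) \<longrightarrow>
        W (v, s, d) + increment M (snd (v i) - fst (v i)) \<le> W (raise v i, s, d)) \<and>
     (\<forall>v s d i j. valid_vehicles M (raise v i) \<longrightarrow> valid_vehicles M (raise v j) \<longrightarrow> i \<noteq> j \<longrightarrow> fst (v i) \<ge> 1 \<longrightarrow> fst (v j) \<ge> 1 \<longrightarrow>
        snd (v i) \<le> snd (v j) \<longrightarrow> fst (v j) + snd (v i) \<le> fst (v i) + snd (v j) \<longrightarrow>
        W (raise v i, s, d) \<le> W (raise v j, s, d))"

lemma regularI:
  assumes "\<And>v s d i. valid_vehicles M (raise v i) \<Longrightarrow> fst (v i) \<ge> 1 \<Longrightarrow>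
      W (raise v i, s, d) \<le> W (v, s, d) + increment M (snd (v i))"
    and "\<And>v s d i. valid_vehicles M (raise v i) \<Longrightarrow> fst (v i) \<ge> 1 \<Longrightarrow> fst (v i) \<le> snd (v i) \<Longrightarrow>
      W (v, s, d) + increment M (snd (v i) - fst (v i)) \<le> W (raise v i, s, d)"
    and "\<And>v s d i j. valid_vehicles M (raise v i) \<Longrightarrow> valid_vehicles M (raise v j) \<Longrightarrow> i \<noteq> j \<Longrightarrow> fst (v i) \<ge> 1 \<Longrightarrow> fst (v j) \<ge> 1 \<Longrightarrow>
      snd (v i) \<le> snd (v j) \<Longrightarrow> fst (v j) + snd (v i) \<le> fst (v i) + snd (v j) \<Longrightarrow>
      W (raise v i, s, d) \<le> W (raise v j, s, d)"
  shows "regular M W"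
  using assms unfolding regular_def by blast

lemma regularD:
  assumes "regular M W"
  shows "\<And>v s d i. valid_vehicles M (raise v i) \<Longrightarrow> fst (v i) \<ge> 1 \<Longrightarrow>
      W (raise v i, s, d) \<le> W (v, s, d) + increment M (snd (v i))"
    and "\<And>v s d i. valid_vehicles M (raise v i) \<Longrightarrow> fst (v i) \<ge> 1 \<Longrightarrow> fst (v i) \<le> snd (v i) \<Longrightarrow>
      W (v, s, d) + increment M (snd (v i) - fst (v i)) \<le> W (raise v i, s, d)"
    and "\<And>v s d i j. valid_vehicles M (raise v i) \<Longrightarrow> valid_vehicles M (raise v j) \<Longrightarrow> i \<noteq> j \<Longrightarrow> fst (v i) \<ge> 1 \<Longrightarrow> fst (v j) \<ge> 1 \<Longrightarrow>
      snd (v i) \<le> snd (v j) \<Longrightarrow> fst (v j) + snd (v i) \<le> fst (v i) + snd (v j) \<Longrightarrow>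
      W (raise v i, s, d) \<le> W (raise v j, s, d)"
  using assms unfolding regular_def by blast+

locale phev_convex =
  fixes M :: "('c::finite, 's::finite, 'd::finite) phev"
  assumes model: "phev_model M"
    and increment_nonneg: "0 \<le> increment M n"
    and increment_Suc: "increment M n \<le> increment M (Suc n)"
begin

lemma increment_mono: "m \<le> n \<Longrightarrow> increment M m \<le> increment M n"
  by (rule lift_Suc_mono_le[of "increment M"]) (rule increment_Suc)

text \<open>The seed of the iteration: the truncated difference is the work left undone even if a
  vehicle is charged at every remaining stage. A raise changes the sum only when
  \<open>fst (v i) \<le> snd (v i)\<close>, by the increment at that amount. This is equality in the
  second clause; nonnegative, monotone increments give the other two.\<close>

lemma regular_overdue_penalty: "regular M (\<lambda>(v, s, d). \<Sum>i\<in>UNIV. penalty M (snd (v i) - fst (v i)))"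
proof -
  define f where "f u = penalty M (snd u - fst u)" for u :: vehicle
  have raise_sum: "(\<Sum>k\<in>UNIV. f (raise v i k)) =
      (\<Sum>k\<in>UNIV. f (v k)) + (f (fst (v i), Suc (snd (v i))) - f (v i))" for v :: "'c \<Rightarrow> vehicle" and i
  proof -
    have split: "(\<Sum>k\<in>UNIV. g k) = g i + (\<Sum>k\<in>UNIV - {i}. g k)" for g :: "'c \<Rightarrow> real"
      by (rule sum.remove) auto
    have "(\<Sum>k\<in>UNIV - {i}. f (raise v i k)) = (\<Sum>k\<in>UNIV - {i}. f (v k))"
      by (rule sum.cong) (auto simp: raise_def)
    then show ?thesis by (simp add: split raise_def)
  qed
  have step: "f (fst u, Suc (snd u)) - f u = (if fst u \<le> snd u then increment M (snd u - fst u) else 0)" for u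
    by (auto simp: f_def increment_def Suc_diff_le)
  have "regular M (\<lambda>(v, s, d). \<Sum>i\<in>UNIV. f (v i))"
    by (rule regularI) (auto simp: raise_sum step increment_nonneg intro: increment_mono)
  then show ?thesis by (simp add: f_def)
qed

lemma regular_convex:
  assumes "regular M W" "regular M W'" "0 < t" "t < 1"
  shows "regular M (\<lambda>x. (1 - t) * W x + t * W' x)"
proof -
  \<comment> \<open>The offset \<open>b\<close> is minus an increment in the first clause, an
    increment in the second and 0 in the third.\<close>
  have comb: "(1 - t) * a + t * a' + b \<le> (1 - t) * c + t * c'" if "a + b \<le> c" "a' + b \<le> c'" for a a' b c c'
  proof -
    have "(1 - t) * (a + b) \<le> (1 - t) * c" "t * (a' + b) \<le> t * c'"
      using assms(3,4) that by (auto intro: mult_left_mono)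
    then show ?thesis by (simp add: algebra_simps)
  qed
  show ?thesis
  proof (rule regularI, goal_cases)
    case (1 v s d i)
    then show ?case using comb[of "W (raise v i, s, d)" "- increment M (snd (v i))" "W (v, s, d)"
        "W' (raise v i, s, d)" "W' (v, s, d)"] regularD(1)[OF assms(1)] regularD(1)[OF assms(2)]
      by (simp add: algebra_simps)
  next
    case 2
    then show ?case using regularD(2)[OF assms(1)] regularD(2)[OF assms(2)] by (intro comb) auto
  next
    case (3 v s d i j)
    then show ?case using comb[of "W (raise v i, s, d)" 0 "W (raise v j, s, d)" "W' (raise v i, s, d)" "W' (raise v j, s, d)"]
       regularD(3)[OF assms(1)] regularD(3)[OF assms(2)] by auto
  qed
qed

lemma regular_add_const:
  assumes "regular M W"
  shows "regular M (\<lambda>x. W x + b)"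
proof (rule regularI, goal_cases)
  case 1 then show ?case using regularD(1)[OF assms] by fastforce
next
  case 2 then show ?case using regularD(2)[OF assms] by fastforce
next
  case 3 then show ?case using regularD(3)[OF assms] by simp
qed

lemma regular_limit:
  assumes "\<And>n. regular M (w n)" and lim: "\<And>x. x \<in> sys_states M \<Longrightarrow> (\<lambda>n. w n x) \<longlonglongrightarrow> W x"
  shows "regular M W"
proof -
  have l: "(\<lambda>n. w n (v, s, d)) \<longlonglongrightarrow> W (v, s, d)" if "valid_vehicles M v" for v s d
    using lim that by (simp add: sys_states_iff)
  show ?thesis
  proof (rule regularI, goal_cases)
    case (1 v s d i)
    show ?case
      using regularD(1)[OF assms(1) 1] l 1 valid_unraise
      by (intro tendsto_le[OF trivial_limit_sequentially tendsto_add[OF l tendsto_const] l]) auto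
  next
    case (2 v s d i)
    show ?case
      using regularD(2)[OF assms(1) 2] l 2 valid_unraise
      by (intro tendsto_le[OF trivial_limit_sequentially l tendsto_add[OF l tendsto_const]]) auto
  next
    case (3 v s d i j)
    show ?case
      using regularD(3)[OF assms(1) 3] 3
      by (intro tendsto_le[OF trivial_limit_sequentially l l]) auto
  qed
qed

section \<open>Slope bounds and interchange for the cost after charging\<close>

lemma advance_staying:
  assumes "fst (v i) \<ge> 2"
  shows "fst (advance v as \<sigma> i) = fst (v i) - 1" "snd (advance v as \<sigma> i) = snd (v i)"
  using assms by (auto simp: advance_def)

lemma post_cost_raise_le:
  assumes W: "regular M W" and ok: "valid_vehicles M (raise v i)" and i: "fst (v i) \<ge> 1"
  shows "post_cost M W (raise v i) s d A \<le> post_cost M W v s d A + increment M (snd (v i))"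
proof (cases "fst (v i) = 1")
  case True
  then show ?thesis
    by (simp add: post_cost_def departure_cost_raise advance_raise increment_def case_prod_unfold)
next
  case False
  then have i2: "fst (v i) \<ge> 2" using i by simp
  have "measure_pmf.expectation (noise M (\<lambda>k. fst (v k)) s d A) (\<lambda>(s', d', as, \<sigma>). W (advance (raise v i) as \<sigma>, s', d'))
    \<le> measure_pmf.expectation (noise M (\<lambda>k. fst (v k)) s d A) (\<lambda>(s', d', as, \<sigma>). W (advance v as \<sigma>, s', d'))
      + increment M (snd (v i))"
  proof (rule noise_expectation_le_add[OF model ok valid_unraise[OF i ok]])
    fix s' d' as \<sigma> assume "valid_vehicles M (advance (raise v i) as \<sigma>)"
    then show "W (advance (raise v i) as \<sigma>, s', d') \<le> W (advance v as \<sigma>, s', d') + increment M (snd (v i))"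
      using regularD(1)[OF W, of "advance v as \<sigma>" i s' d'] i2 advance_staying[of v i as \<sigma>]
      by (simp add: advance_raise)
  qed
  then show ?thesis using False by (simp add: post_cost_def departure_cost_raise)
qed

text \<open>Here \<open>v\<close> is taken after charging but before the stage elapses. The elapsing
  stage turns \<open>fst (v i) \<le> Suc (snd (v i))\<close> into the premise of the lower slope
  bound of \<open>W\<close>; hence the successor in the index.\<close>

lemma post_cost_raise_ge:
  assumes W: "regular M W" and ok: "valid_vehicles M (raise v i)" and i: "fst (v i) \<ge> 1" "fst (v i) \<le> Suc (snd (v i))"
  shows "post_cost M W v s d A + increment M (Suc (snd (v i)) - fst (v i)) \<le> post_cost M W (raise v i) s d A"
proof (cases "fst (v i) = 1")
  case True
  then show ?thesis
    by (simp add: post_cost_def departure_cost_raise advance_raise increment_def case_prod_unfold)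
next
  case False
  then have i2: "fst (v i) \<ge> 2" using i by simp
  let ?c = "increment M (Suc (snd (v i)) - fst (v i))"
  have "measure_pmf.expectation (noise M (\<lambda>k. fst (v k)) s d A) (\<lambda>(s', d', as, \<sigma>). W (advance v as \<sigma>, s', d'))
    \<le> measure_pmf.expectation (noise M (\<lambda>k. fst (v k)) s d A) (\<lambda>(s', d', as, \<sigma>). W (advance (raise v i) as \<sigma>, s', d'))
      + - ?c"
  proof (rule noise_expectation_le_add[OF model valid_unraise[OF i(1) ok] ok])
    fix s' d' as \<sigma> assume "valid_vehicles M (advance (raise v i) as \<sigma>)"
    moreover have "snd (v i) - (fst (v i) - 1) = Suc (snd (v i)) - fst (v i)"
      "Suc 0 \<le> fst (v i) - Suc 0" "fst (v i) - Suc 0 \<le> snd (v i)" using i i2 by simp_all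
    ultimately show "W (advance v as \<sigma>, s', d') \<le> W (advance (raise v i) as \<sigma>, s', d') + - ?c"
      using regularD(2)[OF W, of "advance v as \<sigma>" i s' d'] i i2 advance_staying[of v i as \<sigma>]
      by (simp add: advance_raise)
  qed
  then show ?thesis using False by (simp add: post_cost_def departure_cost_raise)
qed

text \<open>If one of the two vehicles departs first, its penalty increment is paid for by the slope bound
  of \<open>W\<close> at the other one.\<close>

lemma post_cost_interchange:
  assumes W: "regular M W" and ok: "valid_vehicles M (raise v i)" "valid_vehicles M (raise v j)" and ij: "i \<noteq> j"
    and l: "fst (v i) \<ge> 1" "fst (v j) \<ge> 1"
    and g: "snd (v i) \<le> snd (v j)" "fst (v j) + snd (v i) \<le> fst (v i) + snd (v j)"
  shows "post_cost M W (raise v i) s d A \<le> post_cost M W (raise v j) s d A"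
proof -
  let ?E = "\<lambda>v'. measure_pmf.expectation (noise M (\<lambda>k. fst (v k)) s d A) (\<lambda>(s', d', as, \<sigma>). W (advance v' as \<sigma>, s', d'))"
  \<comment> \<open>\<open>?D k\<close> is the rise in departure cost caused by raising
    \<open>k\<close>; moving it to the continuation values leaves a pointwise inequality to
    prove.\<close>
  let ?D = "\<lambda>k. if fst (v k) = 1 then increment M (snd (v k)) else 0"
  have "?E (raise v i) \<le> ?E (raise v j) + (?D j - ?D i)"
  proof (rule noise_expectation_le_add[OF model ok])
    fix s' d' as \<sigma>
    assume a: "valid_vehicles M (advance (raise v i) as \<sigma>)" "valid_vehicles M (advance (raise v j) as \<sigma>)"
    note ai = advance_staying[of v i as \<sigma>] and aj = advance_staying[of v j as \<sigma>]
    consider (ij) "fst (v i) = 1" "fst (v j) = 1" | (i) "fst (v i) = 1" "fst (v j) \<ge> 2"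
      | (j) "fst (v i) \<ge> 2" "fst (v j) = 1" | (none) "fst (v i) \<ge> 2" "fst (v j) \<ge> 2"
      using l by linarith
    then show "W (advance (raise v i) as \<sigma>, s', d') \<le> W (advance (raise v j) as \<sigma>, s', d') + (?D j - ?D i)"
    proof cases
      case ij
      then show ?thesis using increment_mono[OF g(1)] by (simp add: advance_raise)
    next
      case i
      \<comment> \<open>The laxity condition says that the unavoidable work of \<open>j\<close> at
        the next stage is at least \<open>snd (v i)\<close>.\<close>
      then have "increment M (snd (v i)) \<le> increment M (snd (v j) - (fst (v j) - 1))"
        using g by (intro increment_mono) auto
      moreover have "Suc 0 \<le> fst (v j) - Suc 0" "fst (v j) - Suc 0 \<le> snd (v j)" using i g by simp_all
      ultimately show ?thesis
        using i g a regularD(2)[OF W, of "advance v as \<sigma>" j s' d'] aj by (simp add: advance_raise)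
    next
      case j
      moreover have "Suc 0 \<le> fst (v i) - Suc 0" using j by simp
      ultimately show ?thesis
        using g a regularD(1)[OF W, of "advance v as \<sigma>" i s' d'] ai increment_mono[OF g(1)]
        by (simp add: advance_raise)
    next
      case none
      then show ?thesis
        using g a ij regularD(3)[OF W, of "advance v as \<sigma>" i j s' d'] ai aj by (simp add: advance_raise)
    qed
  qed
  then show ?thesis by (auto simp: post_cost_def departure_cost_raise increment_def split: if_splits)
qed


section \<open>The charging model as a finite decision process\<close>

sublocale mdp: finite_mdp "sys_states M" "\<lambda>x. {a. feasible_action x a}" "stage_cost M" "transition M"
proof
  show "finite (sys_states M)" by (rule finite_sys_states)
  show "sys_states M \<noteq> {}" by (auto simp: sys_states_def)
  fix x :: "('c, 's, 'd) sys_state"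
  show "finite {a. feasible_action x a}" by (rule finite_feasible)
  show "{a. feasible_action x a} \<noteq> {}" using feasible_zero[of x] by auto
  fix a assume "x \<in> sys_states M"
  then show "set_pmf (transition M x a) \<subseteq> sys_states M" by (rule transition_closed[OF model])
qed

lemma Q_eq: "mdp.Q W (v, s, d) a = post_cost M W (charge v a) s d (aggregate (v, s, d) a)"
  unfolding mdp.Q_def by (rule stage_cost_plus_expectation)

lemma aggregate_raise: "aggregate (raise v i, s, d) a = aggregate (v, s, d) a"
  by (simp add: aggregate_eq)

text \<open>Both configurations after charging are one-unit raises of the one in which
  \<open>i\<close> and \<open>j\<close> are both charged, and the aggregates agree; an exchange of
  actions is thus a comparison of states.\<close>

lemma Q_swap_le:
  assumes W: "regular M W" and ok: "valid_vehicles M v" and ij: "i \<noteq> j"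
    and l: "fst (v i) \<ge> 1" "fst (v j) \<ge> 1"
    and a: "a i = 1" "a j = 0" and g: "snd (v i) \<ge> 1" "snd (v i) \<le> snd (v j)"
      "fst (v j) + snd (v i) \<le> fst (v i) + snd (v j)"
  shows "mdp.Q W (v, s, d) (a(i := 0, j := 1)) \<le> mdp.Q W (v, s, d) a"
proof -
  let ?u = "charge v (a(j := 1))"
  have eq: "charge v (a(i := 0, j := 1)) = raise ?u i" "charge v a = raise ?u j"
    using a g ij by (auto simp: fun_eq_iff prod_eq_iff)
  have ok_u: "valid_vehicles M (raise ?u i)" "valid_vehicles M (raise ?u j)"
    unfolding eq[symmetric] by (rule valid_charge[OF ok])+
  have "aggregate (v, s, d) (a(i := a j, j := a i)) = aggregate (v, s, d) a"
    by (rule aggregate_swap[OF l ij])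
  moreover have "post_cost M W (raise ?u i) s d A \<le> post_cost M W (raise ?u j) s d A" for A
    by (rule post_cost_interchange[OF W ok_u ij]) (use ij l a g in auto)
  ultimately show ?thesis unfolding Q_eq eq using a by simp
qed

text \<open>In each clause an action optimal for the state on the larger side is used, possibly
  after a swap, at the state on the smaller side; the costs after charging are then
  compared.\<close>

lemma regular_bellman:
  assumes W: "regular M W"
  shows "regular M (mdp.bellman W)"
proof (rule regularI, goal_cases)
  case (1 v s d i)
  have S: "(v, s, d) \<in> sys_states M" "(raise v i, s, d) \<in> sys_states M"
    using 1 valid_unraise by (auto simp: sys_states_iff)
  obtain a where a: "feasible_action (v, s, d) a" "mdp.bellman W (v, s, d) = mdp.Q W (v, s, d) a"
    using mdp.bellman_attained[OF S(1)] by blast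
  then have ai: "a i \<le> snd (v i)" by (auto simp: feasible_iff)
  have "feasible_action (raise v i, s, d) a" using a(1) by (auto simp: feasible_iff le_SucI)
  then have "mdp.bellman W (raise v i, s, d) \<le> mdp.Q W (raise v i, s, d) a"
    using S(2) by (intro mdp.bellman_le) auto
  also have "\<dots> \<le> mdp.Q W (v, s, d) a + increment M (snd (charge v a i))"
    unfolding Q_eq aggregate_raise charge_raise[of a i v, OF ai]
    by (rule post_cost_raise_le[OF W])
      (use valid_charge[OF 1(1), of a] 1 in \<open>simp_all add: charge_raise[of a i v, OF ai]\<close>)
  also have "increment M (snd (charge v a i)) \<le> increment M (snd (v i))" by (rule increment_mono) simp
  finally show ?case using a(2) by simp
next
  case (2 v s d i)
  have S: "(v, s, d) \<in> sys_states M" "(raise v i, s, d) \<in> sys_states M"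
    using 2 valid_unraise by (auto simp: sys_states_iff)
  obtain a where a: "feasible_action (raise v i, s, d) a"
    "mdp.bellman W (raise v i, s, d) = mdp.Q W (raise v i, s, d) a"
    using mdp.bellman_attained[OF S(2)] by blast
  have "a i \<in> {0, 1}" using a(1) by (auto simp: feasible_iff)
  then have ai1: "a i \<le> 1" by auto
  \<comment> \<open>An unfinishable vehicle has work left even without the raise, so the same action
    stays feasible.\<close>
  then have ai: "a i \<le> snd (v i)" using 2 by linarith
  have feas: "feasible_action (v, s, d) a"
    using a(1) ai unfolding feasible_iff raise_simps by metis
  have "mdp.bellman W (v, s, d) \<le> mdp.Q W (v, s, d) a"
    using S(1) feas by (intro mdp.bellman_le) auto
  \<comment> \<open>Charging removes at most one unit, which the successor in
    \<open>post_cost_raise_ge\<close> makes up for.\<close>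
  also have "\<dots> + increment M (snd (v i) - fst (v i)) \<le>
      mdp.Q W (v, s, d) a + increment M (Suc (snd (charge v a i)) - fst (charge v a i))"
    using ai1 by (intro add_left_mono increment_mono) auto
  also have "\<dots> \<le> mdp.Q W (raise v i, s, d) a"
    unfolding Q_eq aggregate_raise charge_raise[of a i v, OF ai]
    by (rule post_cost_raise_ge[OF W])
      (use valid_charge[OF 2(1), of a] 2 ai1 in \<open>auto simp add: charge_raise[of a i v, OF ai]\<close>)
  finally show ?case using a(2) by simp
next
  case (3 v s d i j)
  have S: "(raise v i, s, d) \<in> sys_states M" "(raise v j, s, d) \<in> sys_states M"
    using 3 by (auto simp: sys_states_iff)
  obtain a where a: "feasible_action (raise v j, s, d) a"
    "mdp.bellman W (raise v j, s, d) = mdp.Q W (raise v j, s, d) a"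
    using mdp.bellman_attained[OF S(2)] by blast
  have a01: "a k = 0 \<or> a k = 1" for k using a(1) by (auto simp: feasible_iff)
  have feas: "a k \<le> (if k = j then Suc (snd (v k)) else snd (v k))" for k
    using a(1) unfolding feasible_iff raise_simps by blast
  show ?case
  proof (cases "a i = 0 \<and> a j = 1")
    case True
    \<comment> \<open>When \<open>a\<close> charges \<open>j\<close> but not \<open>i\<close>, the
      swap charges the raised vehicle in either state, and the configurations after charging
      coincide.\<close>
    let ?b = "a(i := a j, j := a i)"
    have "feasible_action (raise v i, s, d) ?b"
      unfolding feasible_iff
    proof
      fix k show "?b k \<in> {0, 1} \<and> ?b k \<le> snd (raise v i k)"
        using a01[of k] feas[of k] True by auto
    qed
    then have "mdp.bellman W (raise v i, s, d) \<le> mdp.Q W (raise v i, s, d) ?b"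
      using S(1) by (intro mdp.bellman_le) auto
    also have "charge (raise v i) ?b = charge (raise v j) a"
      using True 3 by (auto simp: fun_eq_iff prod_eq_iff)
    then have "mdp.Q W (raise v i, s, d) ?b = mdp.Q W (raise v j, s, d) a"
      unfolding Q_eq aggregate_raise using aggregate_swap[of v i j s d a] 3 by simp
    finally show ?thesis using a(2) by simp
  next
    case False
    \<comment> \<open>Otherwise \<open>i\<close> is charged at least as much as \<open>j\<close>, so
      both order conditions survive charging and the same action serves.\<close>
    have aij: "a j \<le> a i" using False a01[of i] a01[of j] by auto
    have ai: "a i \<le> snd (v i)" using feas[of i] 3 by simp
    have aj: "a j \<le> snd (v j)" using ai aij 3 by linarith
    have "feasible_action (raise v i, s, d) a"
      unfolding feasible_iff
    proof
      fix k show "a k \<in> {0, 1} \<and> a k \<le> snd (raise v i k)"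
        using a01[of k] feas[of k] aj by (auto split: if_splits)
    qed
    then have "mdp.bellman W (raise v i, s, d) \<le> mdp.Q W (raise v i, s, d) a"
      using S(1) by (intro mdp.bellman_le) auto
    also have "\<dots> \<le> mdp.Q W (raise v j, s, d) a"
      unfolding Q_eq aggregate_raise charge_raise[of a i v, OF ai] charge_raise[of a j v, OF aj]
      by (rule post_cost_interchange[OF W])
        (use valid_charge[OF 3(1), of a] valid_charge[OF 3(2), of a] 3 aij ai aj in
          \<open>auto simp add: charge_raise[of a i v, OF ai] charge_raise[of a j v, OF aj]\<close>)
    finally show ?thesis using a(2) by simp
  qed
qed

end

section \<open>Accessibility and optimal policies\<close>

text \<open>\<open>succ\<close> selects a demand successor that can occur together with no arrival.
  The two may be dependent, so absence of arrivals cannot be combined with an arbitrary demand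
  transition.\<close>

locale phev_accessible = phev_convex M
  for M :: "('c::finite, 's::finite, 'd::finite) phev" +
  fixes sbar :: 's and succ :: "'d \<Rightarrow> 'd"
  assumes no_arrival: "(succ d, []) \<in> set_pmf (demand M d)"
    and grid_visits: "\<exists>k. (s, sbar) \<in> supp (\<lambda>s. grid M s 0) ^^ k"
    and demand_ergodic: "ergodic_chain (\<lambda>d. map_pmf fst (demand M d))"
begin

abbreviation idle_grid :: "('s \<times> 's) set" where
  "idle_grid \<equiv> supp (\<lambda>s. grid M s 0)"

abbreviation demand_edges :: "('d \<times> 'd) set" where
  "demand_edges \<equiv> supp (\<lambda>d. map_pmf fst (demand M d))"

section \<open>Paths to the hubs\<close>

lemma edgeI: "valid_vehicles M v \<Longrightarrow> y \<in> set_pmf (transition M (v, s, d) (\<mu> (v, s, d))) \<Longrightarrow> ((v, s, d), y) \<in> mdp.edges \<mu>"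
  by (simp add: mdp.edges_def sys_states_iff)

lemma valid_stages_le: "valid_vehicles M v \<Longrightarrow> fst (v i) \<le> max_stages M"
  unfolding valid_vehicles_def vehicle_states_def by (erule allE[of _ i]) auto

lemma valid_empty: "valid_vehicles M v \<Longrightarrow> (\<And>i. fst (v i) = 0) \<Longrightarrow> v = (\<lambda>_. (0, 0))"
  unfolding valid_vehicles_def vehicle_states_def by (rule ext) (metis SigmaE atLeastAtMost_iff fst_conv not_one_le_zero)

lemma no_arrival_step:
  assumes v: "valid_vehicles M v" and s': "s' \<in> set_pmf (grid M s (aggregate (v, s, d) a))"
  shows "\<exists>v'. (v', s', succ d) \<in> set_pmf (transition M (v, s, d) a) \<and> valid_vehicles M v' \<and> (\<forall>i. fst (v' i) = fst (v i) - 1)"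
proof -
  obtain \<sigma> where \<sigma>: "\<sigma> \<in> set_pmf (assign M d (\<lambda>i. fst (v i) - 1) [])"
    using set_pmf_not_empty[of "assign M d (\<lambda>i. fst (v i) - 1) []"] by blast
  then have "ran \<sigma> \<subseteq> {..<length ([] :: vehicle list)}" using model unfolding phev_model_def by blast
  then have none: "\<sigma> i = None" for i by (cases "\<sigma> i") (auto simp: ran_def)
  have "(s', succ d, [], \<sigma>) \<in> set_pmf (noise M (\<lambda>i. fst (v i)) s d (aggregate (v, s, d) a))"
    using s' no_arrival[of d] \<sigma> by (force simp: noise_def)
  then have mem: "(advance (charge v a) [] \<sigma>, s', succ d) \<in> set_pmf (transition M (v, s, d) a)"
    unfolding transition_eq_noise by (force simp: image_iff)
  moreover have "valid_vehicles M (advance (charge v a) [] \<sigma>)"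
    using transition_closed[OF model, of "(v, s, d)" a] mem v by (auto simp: sys_states_iff)
  moreover have "fst (advance (charge v a) [] \<sigma> i) = fst (v i) - 1" for i
    by (auto simp: advance_def none)
  ultimately show ?thesis by blast
qed

lemma demand_step:
  assumes v: "valid_vehicles M v" and s': "s' \<in> set_pmf (grid M s (aggregate (v, s, d) a))" and d': "(d, d') \<in> demand_edges"
  shows "\<exists>v'. (v', s', d') \<in> set_pmf (transition M (v, s, d) a) \<and> valid_vehicles M v'"
proof -
  obtain as where as: "(d', as) \<in> set_pmf (demand M d)" using d' by (auto simp: supp_def)
  obtain \<sigma> where \<sigma>: "\<sigma> \<in> set_pmf (assign M d (\<lambda>i. fst (v i) - 1) as)"
    using set_pmf_not_empty[of "assign M d (\<lambda>i. fst (v i) - 1) as"] by blast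
  have "(s', d', as, \<sigma>) \<in> set_pmf (noise M (\<lambda>i. fst (v i)) s d (aggregate (v, s, d) a))"
    using s' as \<sigma> by (force simp: noise_def)
  then have mem: "(advance (charge v a) as \<sigma>, s', d') \<in> set_pmf (transition M (v, s, d) a)"
    unfolding transition_eq_noise by (force simp: image_iff)
  moreover have "valid_vehicles M (advance (charge v a) as \<sigma>)"
    using transition_closed[OF model, of "(v, s, d)" a] mem v by (auto simp: sys_states_iff)
  ultimately show ?thesis by blast
qed

text \<open>Remaining stages fall by one whatever the rule does; only the grid path depends on
  \<open>\<mu>\<close>, and it is left unspecified.\<close>

lemma drain:
  assumes "valid_vehicles M v"
  shows "\<exists>v' s'. ((v, s, d), (v', s', (succ ^^ n) d)) \<in> (mdp.edges \<mu>)\<^sup>* \<and> valid_vehicles M v' \<and>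
    (\<forall>i. fst (v' i) = fst (v i) - n)"
proof (induction n)
  case 0
  show ?case using assms by auto
next
  case (Suc n)
  then obtain v1 s1 where 1: "((v, s, d), (v1, s1, (succ ^^ n) d)) \<in> (mdp.edges \<mu>)\<^sup>*" "valid_vehicles M v1"
    "\<And>i. fst (v1 i) = fst (v i) - n" by blast
  let ?a = "\<mu> (v1, s1, (succ ^^ n) d)"
  obtain s2 where "s2 \<in> set_pmf (grid M s1 (aggregate (v1, s1, (succ ^^ n) d) ?a))"
    using set_pmf_not_empty[of "grid M s1 (aggregate (v1, s1, (succ ^^ n) d) ?a)"] by blast
  then obtain v2 where 2: "(v2, s2, succ ((succ ^^ n) d)) \<in> set_pmf (transition M (v1, s1, (succ ^^ n) d) ?a)"
    "valid_vehicles M v2" "\<And>i. fst (v2 i) = fst (v1 i) - 1"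
    using no_arrival_step[OF 1(2)] by blast
  have "((v, s, d), (v2, s2, (succ ^^ Suc n) d)) \<in> (mdp.edges \<mu>)\<^sup>*"
    using rtrancl_into_rtrancl[OF 1(1) edgeI[where \<mu> = \<mu>, OF 1(2) 2(1)]] by simp
  then show ?case using 2 1(3) by auto
qed

text \<open>Idleness is demanded only at configurations with stays no longer than in
  \<open>v\<close>; this covers the zero rule, and every rule once the chargers are empty.\<close>

lemma idle_path:
  assumes "valid_vehicles M v" and idle: "\<And>v' s d. valid_vehicles M v' \<Longrightarrow> (\<And>i. fst (v' i) \<le> fst (v i)) \<Longrightarrow>
      aggregate (v', s, d) (\<mu> (v', s, d)) = 0"
    and "(s, s') \<in> idle_grid ^^ n"
  shows "\<exists>v'. ((v, s, d), (v', s', (succ ^^ n) d)) \<in> (mdp.edges \<mu>)\<^sup>* \<and> valid_vehicles M v' \<and>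
    (\<forall>i. fst (v' i) = fst (v i) - n)"
  using assms(3)
proof (induction n arbitrary: s')
  case 0
  then show ?case using assms(1) by auto
next
  case (Suc n)
  then obtain s1 where s1: "(s, s1) \<in> idle_grid ^^ n" "s' \<in> set_pmf (grid M s1 0)" by (auto simp: supp_def)
  obtain v1 where 1: "((v, s, d), (v1, s1, (succ ^^ n) d)) \<in> (mdp.edges \<mu>)\<^sup>*" "valid_vehicles M v1"
    "\<And>i. fst (v1 i) = fst (v i) - n" using Suc.IH[OF s1(1)] by blast
  have "s' \<in> set_pmf (grid M s1 (aggregate (v1, s1, (succ ^^ n) d) (\<mu> (v1, s1, (succ ^^ n) d))))"
    using idle[OF 1(2)] 1(3) s1(2) by simp
  then obtain v2 where 2: "(v2, s', succ ((succ ^^ n) d)) \<in>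
      set_pmf (transition M (v1, s1, (succ ^^ n) d) (\<mu> (v1, s1, (succ ^^ n) d)))"
    "valid_vehicles M v2" "\<And>i. fst (v2 i) = fst (v1 i) - 1"
    using no_arrival_step[OF 1(2)] by blast
  have "((v, s, d), (v2, s', (succ ^^ Suc n) d)) \<in> (mdp.edges \<mu>)\<^sup>*"
    using rtrancl_into_rtrancl[OF 1(1) edgeI[where \<mu> = \<mu>, OF 1(2) 2(1)]] by simp
  then show ?case using 2 1(3) by auto
qed

text \<open>An idling path ends with \<open>max_stages M\<close> steps without arrivals that clear
  the chargers, and these force the demand along \<open>succ\<close>.\<close>

definition hubs :: "('c, 's, 'd) sys_state set" where
  "hubs = range (\<lambda>d. (\<lambda>_. (0, 0), sbar, (succ ^^ max_stages M) d))"

text \<open>Once all vehicles have left, the aggregate is zero under any rule, since it counts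
  connected chargers only; the grid can then move to \<open>sbar\<close> while no vehicle
  arrives.\<close>

lemma policy_reaches_hub:
  assumes "x \<in> sys_states M"
  shows "\<exists>w\<in>hubs. (x, w) \<in> (mdp.edges \<mu>)\<^sup>*"
proof -
  obtain v s d where x: "x = (v, s, d)" by (cases x)
  then have v: "valid_vehicles M v" using assms by (simp add: sys_states_iff)
  let ?B = "max_stages M"
  obtain v1 s1 where 1: "(x, (v1, s1, (succ ^^ ?B) d)) \<in> (mdp.edges \<mu>)\<^sup>*" "valid_vehicles M v1" "\<And>i. fst (v1 i) = fst (v i) - ?B"
    using drain[OF v] unfolding x by blast
  have lam0: "fst (v1 i) = 0" for i using 1(3) valid_stages_le[OF v] by simp
  obtain k where k: "(s1, sbar) \<in> idle_grid ^^ k" using grid_visits by blast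
  have idle: "aggregate (v', s, d) (\<mu> (v', s, d)) = 0" if "\<And>i. fst (v' i) \<le> fst (v1 i)" for v' s d
    using that lam0 by (simp add: aggregate_eq)
  obtain v2 where 2: "((v1, s1, (succ ^^ ?B) d), (v2, sbar, (succ ^^ k) ((succ ^^ ?B) d))) \<in> (mdp.edges \<mu>)\<^sup>*"
    "valid_vehicles M v2" "\<And>i. fst (v2 i) = fst (v1 i) - k"
    using idle_path[where \<mu> = \<mu>, OF 1(2) idle k] by blast
  have "v2 = (\<lambda>_. (0, 0))" using valid_empty[OF 2(2)] 2(3) lam0 by simp
  moreover have "(succ ^^ k) ((succ ^^ ?B) d) = (succ ^^ ?B) ((succ ^^ k) d)"
    by (metis add.commute comp_apply funpow_add)
  ultimately show ?thesis using rtrancl_trans[OF 1(1) 2(1)] by (auto simp: hubs_def)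
qed

text \<open>Leaving \<open>sbar\<close> by one step and returning produces ever later
  visits.\<close>

lemma grid_visits_late: "\<exists>k\<ge>N. (s, sbar) \<in> idle_grid ^^ k"
proof (induction N)
  case 0
  then show ?case using grid_visits by auto
next
  case (Suc N)
  then obtain k where k: "k \<ge> N" "(s, sbar) \<in> idle_grid ^^ k" by blast
  obtain s1 where s1: "(sbar, s1) \<in> idle_grid" using set_pmf_not_empty[of "grid M sbar 0"] by (auto simp: supp_def)
  obtain k' where k': "(s1, sbar) \<in> idle_grid ^^ k'" using grid_visits by blast
  have "(s, s1) \<in> idle_grid ^^ Suc k" using k(2) s1 by auto
  then have "(s, sbar) \<in> idle_grid ^^ (Suc k + k')" using k' unfolding relpow_add by (rule relcompI)
  then show ?case using k(1) by (intro exI[of _ "Suc k + k'"]) auto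
qed

text \<open>Under zero charging the grid and demand chains are independent; once the demand chain reaches
  every state in exactly \<open>n\<close> steps for all large \<open>n\<close>, periodicity of the grid chain does no harm.\<close>

lemma idling_reaches_hub:
  assumes "x \<in> sys_states M" "w \<in> hubs"
  shows "(x, w) \<in> (mdp.edges (\<lambda>_ _. 0))\<^sup>*"
proof -
  let ?\<mu> = "\<lambda>_ _. 0 :: nat" and ?B = "max_stages M"
  obtain v s d where x: "x = (v, s, d)" by (cases x)
  then have v: "valid_vehicles M v" using assms by (simp add: sys_states_iff)
  obtain d1 where w: "w = (\<lambda>_. (0, 0), sbar, (succ ^^ ?B) d1)" using assms(2) by (auto simp: hubs_def)
  obtain n0 where n0: "\<And>n. n \<ge> n0 \<Longrightarrow> (d, d1) \<in> demand_edges ^^ n"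
    using ergodic_eventually_reaches[OF demand_ergodic] by blast
  \<comment> \<open>\<open>?B\<close> steps are reserved for clearing the chargers; the first
    \<open>n\<close> still suffice to bring the demand to \<open>d1\<close>.\<close>
  obtain k where k: "k \<ge> n0 + ?B" "(s, sbar) \<in> idle_grid ^^ k" using grid_visits_late by blast
  define n where "n = k - ?B"
  have "(s, sbar) \<in> idle_grid ^^ (n + ?B)" using k by (simp add: n_def)
  then obtain s1 where s1: "(s, s1) \<in> idle_grid ^^ n" "(s1, sbar) \<in> idle_grid ^^ ?B"
    unfolding relpow_add by blast
  have idle: "aggregate y (\<lambda>_. 0) = 0" for y :: "('c, 's, 'd) sys_state" by (simp add: aggregate_def)
  \<comment> \<open>In this first phase any arrivals that accompany the chosen demand transitions
    are accepted.\<close>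
  have path: "\<exists>v'. (x, (v', t, e)) \<in> (mdp.edges ?\<mu>)\<^sup>* \<and> valid_vehicles M v'"
    if "(s, t) \<in> idle_grid ^^ m" "(d, e) \<in> demand_edges ^^ m" for m t e
    using that
  proof (induction m arbitrary: t e)
    case 0
    then show ?case using v by (auto simp: x)
  next
    case (Suc m)
    then obtain t1 e1 where te: "(s, t1) \<in> idle_grid ^^ m" "(d, e1) \<in> demand_edges ^^ m"
      "t \<in> set_pmf (grid M t1 0)" "(e1, e) \<in> demand_edges"
      by (auto simp: supp_def)
    obtain v1 where 1: "(x, (v1, t1, e1)) \<in> (mdp.edges ?\<mu>)\<^sup>*" "valid_vehicles M v1" using Suc.IH[OF te(1,2)] by blast
    obtain v2 where 2: "(v2, t, e) \<in> set_pmf (transition M (v1, t1, e1) (\<lambda>_. 0))" "valid_vehicles M v2"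
      using demand_step[OF 1(2), of t t1 e1 "\<lambda>_. 0" e] te idle by auto
    show ?case using rtrancl_into_rtrancl[OF 1(1) edgeI[where \<mu> = ?\<mu>, OF 1(2) 2(1)]] 2(2) by blast
  qed
  have "n \<ge> n0" using k by (simp add: n_def)
  then obtain v1 where 1: "(x, (v1, s1, d1)) \<in> (mdp.edges ?\<mu>)\<^sup>*" "valid_vehicles M v1" using path[OF s1(1) n0] by blast
  obtain v2 where 2: "((v1, s1, d1), (v2, sbar, (succ ^^ ?B) d1)) \<in> (mdp.edges ?\<mu>)\<^sup>*"
    "valid_vehicles M v2" "\<And>i. fst (v2 i) = fst (v1 i) - ?B"
    using idle_path[where \<mu> = ?\<mu>, OF 1(2) idle s1(2)] by blast
  have "v2 = (\<lambda>_. (0, 0))" using valid_empty[OF 2(2)] 2(3) valid_stages_le[OF 1(2)] by simp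
  then show ?thesis using rtrancl_trans[OF 1(1) 2(1)] by (simp add: w)
qed

lemma regular_acoe_solution:
  "\<exists>\<rho> h. regular M h \<and> (\<forall>x\<in>sys_states M. mdp.bellman h x = \<rho> + h x)"
  by (rule mdp.acoe_solution_in_class[where Z = hubs and \<nu> = "\<lambda>_ _. 0"])
    (use idling_reaches_hub policy_reaches_hub feasible_zero regular_overdue_penalty regular_bellman
      regular_convex regular_add_const regular_limit in \<open>blast+\<close>)

lemma optimal_stationaryI:
  assumes acoe: "\<And>x. x \<in> sys_states M \<Longrightarrow> mdp.bellman h x = \<rho> + h x"
    and \<mu>: "\<And>x. x \<in> sys_states M \<Longrightarrow> feasible_action x (\<mu> x) \<and> mdp.Q h x (\<mu> x) = mdp.bellman h x"
  shows "optimal_stationary M \<mu>"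
  unfolding optimal_stationary_def
proof (intro conjI ballI allI impI)
  show "feasible_policy M (stationary \<mu>)" using \<mu> by (simp add: feasible_policy_def stationary_def)
  fix x \<pi> assume x: "x \<in> sys_states M" and \<pi>: "feasible_policy M \<pi>"
  have cost: "average_cost M \<pi>' x = limsup (\<lambda>T. ereal (1 / real T * mdp.total_cost \<pi>' x T))" for \<pi>'
    by (simp add: average_cost_def expected_cost_def mdp.total_cost_def mdp.run_def)
  have "mdp.admissible \<pi>" using \<pi> by (simp add: mdp.admissible_def feasible_policy_def)
  then show "average_cost M (stationary \<mu>) x \<le> average_cost M \<pi> x"
    unfolding cost unfolding stationary_def using \<mu> x by (intro mdp.greedy_optimal[OF acoe]) auto
qed

end

text \<open>As both vehicles have work left, their laxities are true differences rather than the
  default \<open>max_stages M\<close>; the additive form avoids truncated subtraction.\<close>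

lemma has_priorityD:
  assumes "has_priority M (v, s, d) i j" "snd (v i) \<ge> 1"
  shows "fst (v i) \<ge> 1" "fst (v j) \<ge> 1" "snd (v i) \<le> snd (v j)" "fst (v j) + snd (v i) \<le> fst (v i) + snd (v j)"
    "i \<noteq> j"
  using assms by (auto simp: has_priority_def connected_chargers_def lam_def gam_def laxity_def)

section \<open>Tie-breaking by priority\<close>

context phev_accessible
begin

lemma optimal_priority_policy:
  "\<exists>\<mu>. optimal_stationary M \<mu> \<and>
    (\<forall>x \<in> sys_states M. \<forall>i j. \<mu> x i = 1 \<longrightarrow> has_priority M x i j \<longrightarrow> \<mu> x j = 1)"
proof -
  obtain \<rho> h where h: "regular M h" and acoe: "\<And>x. x \<in> sys_states M \<Longrightarrow> mdp.bellman h x = \<rho> + h x"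
    using regular_acoe_solution by blast
  define best where "best x = {a. feasible_action x a \<and> mdp.Q h x a = mdp.bellman h x}" for x
  \<comment> \<open>The weight of \<open>j\<close> strictly exceeds that of \<open>i\<close> when
    \<open>j\<close> has priority: both terms favour \<open>j\<close> weakly and one does so
    strictly.\<close>
  define rank where "rank x a = (\<Sum>i\<in>UNIV. int (a i) * (int (gam x i) - laxity M x i))" for x and a :: "'c action"
  have best: "finite (best x)" "best x \<noteq> {}" if "x \<in> sys_states M" for x
    using finite_subset[OF _ finite_feasible[of x], of "best x"] mdp.bellman_attained[OF that, of h]
    by (auto simp: best_def)
  have "\<exists>a\<in>best x. \<forall>b\<in>best x. rank x b \<le> rank x a" if "x \<in> sys_states M" for x
  proof -
    have "Max (rank x ` best x) \<in> rank x ` best x" using best[OF that] by (intro Max_in) auto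
    then obtain a where a: "a \<in> best x" "Max (rank x ` best x) = rank x a" by auto
    have "rank x b \<le> rank x a" if b: "b \<in> best x" for b
      unfolding a(2)[symmetric] using best(1)[OF \<open>x \<in> sys_states M\<close>] b by simp
    then show ?thesis using a(1) by blast
  qed
  then obtain \<mu> where \<mu>: "\<And>x. x \<in> sys_states M \<Longrightarrow> \<mu> x \<in> best x"
    and \<mu>_max: "\<And>x b. x \<in> sys_states M \<Longrightarrow> b \<in> best x \<Longrightarrow> rank x b \<le> rank x (\<mu> x)"
    by metis
  have "optimal_stationary M \<mu>" by (rule optimal_stationaryI[OF acoe]) (use \<mu> in \<open>auto simp: best_def\<close>)
  moreover have "\<mu> x j = 1" if x: "x \<in> sys_states M" and i: "\<mu> x i = 1" and prio: "has_priority M x i j" for x i j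
  proof (rule ccontr)
    assume "\<mu> x j \<noteq> 1"
    obtain v s d where vsd: "x = (v, s, d)" by (cases x)
    let ?a = "\<mu> x" and ?b = "(\<mu> x)(i := 0, j := 1)"
    have feas: "\<And>k. ?a k \<in> {0, 1} \<and> ?a k \<le> snd (v k)"
      using \<mu>[OF x] by (auto simp: best_def vsd feasible_iff)
    have j: "?a j = 0" using feas[of j] \<open>\<mu> x j \<noteq> 1\<close> by auto
    have gi: "snd (v i) \<ge> 1" using feas[of i] i by auto
    note D = has_priorityD[OF prio[unfolded vsd] gi]
    have "feasible_action x ?b" unfolding vsd feasible_iff
      using feas D gi by (auto simp: vsd)
    \<comment> \<open>The swapped action is therefore again minimising, while its rank is strictly
      larger, contrary to the choice of \<open>\<mu>\<close>.\<close>
    moreover have "mdp.Q h x ?b \<le> mdp.Q h x ?a"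
      using Q_swap_le[OF h, of v i j ?a s d] D gi i j x by (simp add: vsd sys_states_iff)
    ultimately have "?b \<in> best x"
      using \<mu>[OF x] mdp.bellman_le[OF x, of ?b h] by (auto simp: best_def)
    then have le: "rank x ?b \<le> rank x ?a" by (rule \<mu>_max[OF x])
    let ?r = "\<lambda>k. int (gam x k) - laxity M x k"
    have split: "rank x b = int (b i) * ?r i + (int (b j) * ?r j + (\<Sum>k\<in>UNIV - {i} - {j}. int (b k) * ?r k))" for b
      unfolding rank_def using D(5) by (subst sum.remove[of _ i], simp, simp, subst sum.remove[of _ j]) auto
    have "(\<Sum>k\<in>UNIV - {i} - {j}. int (?b k) * ?r k) = (\<Sum>k\<in>UNIV - {i} - {j}. int (?a k) * ?r k)"
      by (rule sum.cong) auto
    then have "?r j \<le> ?r i" using le D(5) i j unfolding split by simp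
    then show False using prio by (auto simp: has_priority_def)
  qed
  ultimately show ?thesis by blast
qed

end

theorem mainTheorem2:
  fixes M :: "('c::finite, 's::finite, 'd::finite) phev"
  assumes model: "phev_model M"
    and A: "\<And>n. n \<ge> 1 \<Longrightarrow>
      0 \<le> penalty M n - penalty M (n - 1) \<and>
      penalty M n - penalty M (n - 1) \<le> penalty M (n + 1) - penalty M n"
    and B1: "\<And>d. measure_pmf.prob (demand M d) {(d', as). as = []} > 0"
    and B2: "\<exists>sbar m. m > 0 \<and>
      (\<forall>s\<^sub>0. measure_pmf.prob (traj (\<lambda>t s. grid M s 0) s\<^sub>0 m) {ss. sbar \<in> set ss} > 0)"
    and B3: "ergodic_chain (\<lambda>d. map_pmf fst (demand M d))"
  shows "\<exists>\<mu>. optimal_stationary M \<mu> \<and>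
    (\<forall>x \<in> sys_states M. \<forall>i j. \<mu> x i = 1 \<longrightarrow> has_priority M x i j \<longrightarrow> \<mu> x j = 1)"
proof -
  \<comment> \<open>(B1) and (B2) are turned into statements about supports, and hence about
    paths.\<close>
  have pos_prob: "\<exists>w\<in>set_pmf p. w \<in> E" if "measure_pmf.prob p E > 0" for p :: "'w pmf" and E
    using that measure_pmf_zero_iff[of p E] by auto
  have "\<exists>d'. (d', []) \<in> set_pmf (demand M d)" for d
    using pos_prob[OF B1[of d]] by auto
  then obtain succ where succ: "\<And>d. (succ d, []) \<in> set_pmf (demand M d)" by metis
  obtain sbar m where B2': "\<And>s\<^sub>0. measure_pmf.prob (traj (\<lambda>t s. grid M s 0) s\<^sub>0 m) {ss. sbar \<in> set ss} > 0"
    using B2 by blast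
  interpret phev_accessible M sbar succ
  proof
    show "phev_model M" by (rule model)
    show "0 \<le> increment M n" "increment M n \<le> increment M (Suc n)" for n
      using A[of "Suc n"] by (auto simp: increment_def)
    show "(succ d, []) \<in> set_pmf (demand M d)" for d by (rule succ)
    show "\<exists>k. (s, sbar) \<in> supp (\<lambda>s. grid M s 0) ^^ k" for s
      using pos_prob[OF B2'[of s]] traj_visits[of _ "\<lambda>s. grid M s 0" s m sbar] by blast
    show "ergodic_chain (\<lambda>d. map_pmf fst (demand M d))" by (rule B3)
  qed
  show ?thesis by (rule optimal_priority_policy)
qed

end
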